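(* Let $p\geq 1$, $c=5/6$ and $\alpha=1/2$. There is a deterministic polynomial-time (Karp) reduction from $\mathsf{SS}_{c}^{p,\alpha}$ to $\mathsf{GapSVP}_p$ that reduces instances with $n$ weights to instances with a lattice of rank $n+1$.
   Context: $\mathbb{N}$ denotes the positive integers. For $1\le p<\infty$, $\|\mathbf{x}\|_p=(\sum_i|x_i|^p)^{1/p}$. $p$-dependency: for $0<\alpha<1$ and $p\ge1$, non-negative integers $a_1,\ldots,a_n$ are called $p$-dependent with respect to $\alpha$ if there exists $\mathbf{x}=(x_1,\ldots,x_n)\in\mathbb{Z}^n$, $\mathbf{x}\ne\mathbf{0}$, such that $\sum_{i=1}^n a_ix_i=0$, $\sum_{i=1}^n x_i=0$ and $\|\mathbf{x}\|_p\le\alpha\cdot n^{1/p}$. The $c$-full subset-sum problem $\mathsf{SS}_c$, for a constant $c\in(0,1)$: given $s\in\mathbb{N}$ and non-negative integers $a_1,\ldots,a_n$ (the weights) such that $cn\in\mathbb{N}$, decide whether there exists $(x_1,\ldots,x_n)\in\{0,1\}^n$ with $\sum_{i=1}^n a_ix_i=s$ and $|\{i:x_i=1\}|=cn$ (YES-instance) or not (NO-instance). $\mathsf{SS}_c^{p,\alpha}$ denotes $\mathsf{SS}_c$ restricted to inputs $a_1,\ldots,a_n$ that are not $p$-dependent with respect to $\alpha$. A lattice $\mathcal{L}$ of rank $n$ and dimension $m$ is the set of all integer linear combinations of $n$ linearly independent vectors in $\mathbb{R}^m$; $\lambda_{1,p}(\mathcal{L})=\min_{\mathbf{v}\in\mathcal{L}\setminus\{0\}}\|\mathbf{v}\|_p$.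 The (exact) problem $\mathsf{GapSVP}_p$: given a lattice $\mathcal{L}$ and a distance threshold $\delta>0$, decide whether $\lambda_{1,p}(\mathcal{L})\le\delta$ (YES-instance) or $\lambda_{1,p}(\mathcal{L})>\delta$ (NO-instance). *)

theory Defs
  imports
    "Jordan_Normal_Form.DL_Rank"
    "HOL-Computational_Algebra.Polynomial"
begin

text \<open>
  The machine model consists of structured programs over finitely many stacks of bits, with unit cost
  per elementary step. It is a syntactic variant of the deterministic multitape Turing machine:
  a tape is a pair of stacks (the parts to the left and to the right of the head), a stack is a tape
  whose head stays at the end of the written part, and the control state of a machine
  can be kept in a bounded number of stacks of bounded height. These simulations lose only constant
  factors in the running time.

  \<open>Branch r c0 c1 c2\<close> runs \<open>c0\<close>, \<open>c1\<close>, \<open>c2\<close> if stack \<open>r\<close> is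
  empty, has \<open>False\<close> on top, has \<open>True\<close> on top, respectively.
\<close>

datatype prog =
    Skip
  | Push nat bool
  | Pop nat
  | Seq prog prog
  | Branch nat prog prog prog
  | While nat prog

type_synonym store = "nat \<Rightarrow> bool list"

text \<open>\<open>exec c s t s'\<close>: started in \<open>s\<close>, program \<open>c\<close> halts after \<open>t\<close> steps in \<open>s'\<close>.\<close>

inductive exec :: "prog \<Rightarrow> store \<Rightarrow> nat \<Rightarrow> store \<Rightarrow> bool" where
  Skip: "exec Skip s 1 s"
| Push: "exec (Push r b) s 1 (s(r := b # s r))"
| Pop: "exec (Pop r) s 1 (s(r := tl (s r)))"
| Seq: "exec c1 s t1 s1 \<Longrightarrow> exec c2 s1 t2 s2 \<Longrightarrow> exec (Seq c1 c2) s (t1 + t2) s2"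
| Branch_Nil: "s r = [] \<Longrightarrow> exec c0 s t s' \<Longrightarrow> exec (Branch r c0 c1 c2) s (Suc t) s'"
| Branch_False: "s r = False # w \<Longrightarrow> exec c1 s t s' \<Longrightarrow> exec (Branch r c0 c1 c2) s (Suc t) s'"
| Branch_True: "s r = True # w \<Longrightarrow> exec c2 s t s' \<Longrightarrow> exec (Branch r c0 c1 c2) s (Suc t) s'"
| While_Nil: "s r = [] \<Longrightarrow> exec (While r c) s 1 s"
| While_Cons: "s r \<noteq> [] \<Longrightarrow> exec c s t1 s1 \<Longrightarrow> exec (While r c) s1 t2 s2 \<Longrightarrow>
    exec (While r c) s (Suc (t1 + t2)) s2"

inductive_cases exec_elims:
  "exec Skip s t s'" "exec (Push r b) s t s'" "exec (Pop r) s t s'" "exec (Seq c1 c2) s t s'"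
  "exec (Branch r c0 c1 c2) s t s'" "exec (While r c) s t s'"

lemma exec_deterministic:
  "exec c s t s' \<Longrightarrow> exec c s u s'' \<Longrightarrow> u = t \<and> s'' = s'"
proof (induction arbitrary: u s'' rule: exec.induct)
  case (Seq c1 s t1 s1 c2 t2 s2)
  from Seq.prems obtain t1' s1' t2' where
    "exec c1 s t1' s1'" "exec c2 s1' t2' s''" "u = t1' + t2'"
    by (rule exec_elims(4))
  with Seq.IH show ?case by blast
next
  case (Branch_Nil s r c0 t s' c1 c2)
  from Branch_Nil.prems obtain t' where "u = Suc t'" "exec c0 s t' s''"
    by (rule exec_elims(5)) (use Branch_Nil.hyps in simp_all)
  with Branch_Nil.IH show ?case by blast
next
  case (Branch_False s r w c1 t s' c0 c2)
  from Branch_False.prems obtain t' where "u = Suc t'" "exec c1 s t' s''"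
    by (rule exec_elims(5)) (use Branch_False.hyps in simp_all)
  with Branch_False.IH show ?case by blast
next
  case (Branch_True s r w c2 t s' c0 c1)
  from Branch_True.prems obtain t' where "u = Suc t'" "exec c2 s t' s''"
    by (rule exec_elims(5)) (use Branch_True.hyps in simp_all)
  with Branch_True.IH show ?case by blast
next
  case (While_Nil s r c)
  from While_Nil.prems show ?case
    by (rule exec_elims(6)) (use While_Nil.hyps in simp_all)
next
  case (While_Cons s r c t1 s1 t2 s2)
  from While_Cons.prems obtain t1' s1' t2' where
    "exec c s t1' s1'" "exec (While r c) s1' t2' s''" "u = Suc (t1' + t2')"
    by (rule exec_elims(6)) (use While_Cons.hyps in simp_all)
  with While_Cons.IH show ?case by blast
qed (erule exec_elims(1-3), simp)+

text \<open>The input is the initial content of stack 0 (the other stacks being empty),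
  the output is its final content.\<close>

definition poly_time :: "(bool list \<Rightarrow> bool list) \<Rightarrow> bool" where
  "poly_time f \<longleftrightarrow> (\<exists>c. \<exists>q :: nat poly. \<forall>w. \<exists>t s.
     exec c ((\<lambda>_. [])(0 := w)) t s \<and> s 0 = f w \<and> t \<le> poly q (length w))"

text \<open>A promise problem is the pair of its set of YES-instances and its set of NO-instances.\<close>

type_synonym promise_problem = "bool list set \<times> bool list set"

definition karp_reduction :: "(bool list \<Rightarrow> bool list) \<Rightarrow> promise_problem \<Rightarrow> promise_problem \<Rightarrow> bool"
  where "karp_reduction f P Q \<longleftrightarrow>
    poly_time f \<and> f ` fst P \<subseteq> fst Q \<and> f ` snd P \<subseteq> snd Q"

text \<open>Numbers are written in binary (least significant bit first, no superfluous zeros). Every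
  encoding is self-delimiting: in a list, \<open>True\<close> announces a further element and
  \<open>False\<close> is the end marker. Its length is linear in the usual binary size.\<close>

fun bits :: "nat \<Rightarrow> bool list" where
  "bits n = (if n = 0 then [] else odd n # bits (n div 2))"

declare bits.simps [simp del]

fun enc_list :: "('a \<Rightarrow> bool list) \<Rightarrow> 'a list \<Rightarrow> bool list" where
  "enc_list e [] = [False]"
| "enc_list e (x # xs) = True # e x @ enc_list e xs"

definition enc_nat :: "nat \<Rightarrow> bool list" where
  "enc_nat n = enc_list (\<lambda>b. [b]) (bits n)"

definition enc_int :: "int \<Rightarrow> bool list" where
  "enc_int k = (k < 0) # enc_nat (nat \<bar>k\<bar>)"

definition enc_rat :: "rat \<Rightarrow> bool list" where
  "enc_rat r = enc_int (fst (quotient_of r)) @ enc_int (snd (quotient_of r))"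

definition enc_ss :: "nat list \<Rightarrow> nat \<Rightarrow> bool list" where
  "enc_ss a s = enc_nat s @ enc_list enc_nat a"

text \<open>\<open>B\<close> is the matrix whose columns are the basis vectors; for the role of
  \<open>u\<close> and \<open>v\<close> see \<open>threshold\<close> below.\<close>

definition enc_gapsvp :: "rat mat \<Rightarrow> rat \<Rightarrow> rat \<Rightarrow> bool list" where
  "enc_gapsvp B u v =
     enc_rat u @ enc_rat v @ enc_list (\<lambda>b. enc_list enc_rat (list_of_vec b)) (cols B)"

text \<open>The encodings are injective, so instances can be recovered from their codes (for
  matrices with at least one column).\<close>

definition prefix_code :: "('a \<Rightarrow> bool list) \<Rightarrow> bool" where
  "prefix_code e \<longleftrightarrow> (\<forall>x y w z. e x @ w = e y @ z \<longrightarrow> x = y \<and> w = z)"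

lemma prefix_codeD: "prefix_code e \<Longrightarrow> e x @ w = e y @ z \<Longrightarrow> x = y \<and> w = z"
  unfolding prefix_code_def by blast

lemma prefix_code_list:
  assumes e: "prefix_code e"
  shows "prefix_code (enc_list e)"
  unfolding prefix_code_def
proof (intro allI impI)
  fix xs ys w z
  show "enc_list e xs @ w = enc_list e ys @ z \<Longrightarrow> xs = ys \<and> w = z"
  proof (induction xs arbitrary: ys)
    case Nil
    then show ?case by (cases ys) auto
  next
    case (Cons x xs)
    then obtain y ys' where ys: "ys = y # ys'" by (cases ys) auto
    with Cons.prems have "e x @ (enc_list e xs @ w) = e y @ (enc_list e ys' @ z)" by simp
    from prefix_codeD[OF e this] Cons.IH ys show ?case by blast
  qed
qed

lemma inj_bits: "bits m = bits n \<Longrightarrow> m = n"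
proof (induction m arbitrary: n rule: less_induct)
  case (less m)
  show ?case
  proof (cases "m = 0 \<or> n = 0")
    case True
    with less.prems show ?thesis
      by (metis bits.simps list.distinct(1))
  next
    case False
    then have "odd m = odd n" "bits (m div 2) = bits (n div 2)"
      using less.prems bits.simps[of m] bits.simps[of n] by auto
    moreover have "m div 2 < m" using False by auto
    ultimately have "m div 2 = n div 2" "m mod 2 = n mod 2"
      using less.IH[of "m div 2" "n div 2"] by (simp_all add: mod2_eq_if)
    then show ?thesis by (metis div_mult_mod_eq)
  qed
qed

lemma prefix_code_nat: "prefix_code enc_nat"
proof -
  have "prefix_code (enc_list (\<lambda>b. [b]))"
    by (rule prefix_code_list) (simp add: prefix_code_def)
  then show ?thesis
    unfolding prefix_code_def enc_nat_def using inj_bits by blast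
qed

lemma prefix_code_int: "prefix_code enc_int"
  unfolding prefix_code_def enc_int_def
proof (intro allI impI)
  fix x y w z
  assume eq: "((x < 0) # enc_nat (nat \<bar>x\<bar>)) @ w = ((y < 0) # enc_nat (nat \<bar>y\<bar>)) @ z"
  then have "enc_nat (nat \<bar>x\<bar>) @ w = enc_nat (nat \<bar>y\<bar>) @ z" by simp
  from prefix_codeD[OF prefix_code_nat this] eq show "x = y \<and> w = z" by auto
qed

lemma prefix_code_rat: "prefix_code enc_rat"
  unfolding prefix_code_def enc_rat_def
proof (intro allI impI)
  fix x y w z
  assume "(enc_int (fst (quotient_of x)) @ enc_int (snd (quotient_of x))) @ w =
    (enc_int (fst (quotient_of y)) @ enc_int (snd (quotient_of y))) @ z"
  then have eq: "enc_int (fst (quotient_of x)) @ (enc_int (snd (quotient_of x)) @ w) =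
    enc_int (fst (quotient_of y)) @ (enc_int (snd (quotient_of y)) @ z)" by simp
  from prefix_codeD[OF prefix_code_int eq]
  have fst: "fst (quotient_of x) = fst (quotient_of y)"
    and eq': "enc_int (snd (quotient_of x)) @ w = enc_int (snd (quotient_of y)) @ z" by auto
  from fst prefix_codeD[OF prefix_code_int eq'] show "x = y \<and> w = z"
    using quotient_of_inject prod_eqI by blast
qed

lemma inj_enc_ss: "enc_ss a s = enc_ss a' s' \<longleftrightarrow> a = a' \<and> s = s'"
proof
  assume "enc_ss a s = enc_ss a' s'"
  then have "enc_nat s @ enc_list enc_nat a = enc_nat s' @ enc_list enc_nat a'"
    by (simp only: enc_ss_def)
  from prefix_codeD[OF prefix_code_nat this]
    prefix_codeD[OF prefix_code_list[OF prefix_code_nat], of a "[]" a' "[]"]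
  show "a = a' \<and> s = s'" by simp
qed simp

lemma inj_enc_gapsvp:
  assumes eq: "enc_gapsvp B u v = enc_gapsvp B' u' v'" and col: "0 < dim_col B"
  shows "B = B' \<and> u = u' \<and> v = v'"
proof -
  let ?e = "\<lambda>b :: rat vec. enc_list enc_rat (list_of_vec b)"
  have "prefix_code ?e"
    using prefix_code_list[OF prefix_code_rat] unfolding prefix_code_def
    by (metis vec_list)
  note code = prefix_codeD[OF prefix_code_list[OF this], of "cols B" "[]" "cols B'" "[]"]
  have u: "u = u' \<and> enc_rat v @ enc_list ?e (cols B) = enc_rat v' @ enc_list ?e (cols B')"
    by (rule prefix_codeD[OF prefix_code_rat]) (use eq in \<open>simp only: enc_gapsvp_def\<close>)
  then have v: "v = v' \<and> enc_list ?e (cols B) = enc_list ?e (cols B')"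
    by (intro prefix_codeD[OF prefix_code_rat]) simp
  then have cols: "cols B = cols B'" using code by simp
  then have c: "dim_col B = dim_col B'" by (metis cols_length)
  have "dim_row B = dim_vec (cols B ! 0)" "dim_row B' = dim_vec (cols B' ! 0)"
    using col c by auto
  then have "dim_row B = dim_row B'" using cols by simp
  then have "B = B'" using cols mat_of_cols_cols by metis
  with u v show ?thesis by blast
qed

definition lp_norm :: "real \<Rightarrow> real vec \<Rightarrow> real" where
  "lp_norm p x = (\<Sum>i<dim_vec x. \<bar>x $ i\<bar> powr p) powr (1 / p)"

definition p_dependent :: "real \<Rightarrow> real \<Rightarrow> nat list \<Rightarrow> bool" where
  "p_dependent p \<alpha> a \<longleftrightarrow> (\<exists>x :: int vec. x \<in> carrier_vec (length a) \<and> x \<noteq> 0\<^sub>v (length a) \<and>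
     (\<Sum>i<length a. int (a ! i) * x $ i) = 0 \<and>
     (\<Sum>i<length a. x $ i) = 0 \<and>
     lp_norm p (map_vec real_of_int x) \<le> \<alpha> * real (length a) powr (1 / p))"

definition ss_instance :: "real \<Rightarrow> nat list \<Rightarrow> nat \<Rightarrow> bool" where
  "ss_instance c a s \<longleftrightarrow> 0 < s \<and> (\<exists>k :: nat. 0 < k \<and> c * real (length a) = real k)"

definition ss_solvable :: "real \<Rightarrow> nat list \<Rightarrow> nat \<Rightarrow> bool" where
  "ss_solvable c a s \<longleftrightarrow> (\<exists>x :: nat vec. x \<in> carrier_vec (length a) \<and>
     (\<forall>i<length a. x $ i \<in> {0, 1}) \<and>
     (\<Sum>i<length a. a ! i * x $ i) = s \<and>
     real (card {i. i < length a \<and> x $ i = 1}) = c * real (length a))"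

definition SS :: "real \<Rightarrow> real \<Rightarrow> real \<Rightarrow> promise_problem" where
  "SS c p \<alpha> =
    ({enc_ss a s | a s. ss_instance c a s \<and> \<not> p_dependent p \<alpha> a \<and> ss_solvable c a s},
     {enc_ss a s | a s. ss_instance c a s \<and> \<not> p_dependent p \<alpha> a \<and> \<not> ss_solvable c a s})"

definition is_basis :: "real mat \<Rightarrow> bool" where
  "is_basis B \<longleftrightarrow> distinct (cols B) \<and>
     module.lin_indpt class_ring (module_vec TYPE(real) (dim_row B)) (set (cols B))"

text \<open>If \<open>is_basis B\<close>, then this is a lattice of rank \<open>dim_col B\<close> and dimension
  \<open>dim_row B\<close>.\<close>

definition lattice_of :: "real mat \<Rightarrow> real vec set" where
  "lattice_of B = {B *\<^sub>v map_vec real_of_int z | z. z \<in> carrier_vec (dim_col B)}"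

text \<open>\<open>LEAST\<close> is the minimum: it is attained for every lattice of positive rank.\<close>

definition lambda1 :: "real \<Rightarrow> real vec set \<Rightarrow> real" where
  "lambda1 p L = (LEAST r. \<exists>v\<in>L. v \<noteq> 0\<^sub>v (dim_vec v) \<and> r = lp_norm p v)"

text \<open>The distance thresholds that occur for the \<open>\<ell>\<^sub>p\<close> norm, such as norms of rational
  vectors, are in general irrational \<open>p\<close>-th roots. We therefore represent \<open>\<delta>\<close> by two positive
  rationals with \<open>\<delta> = u * v powr (1 / p)\<close>. This covers both rational thresholds (\<open>v = 1\<close>)
  and thresholds with rational \<open>p\<close>-th power (\<open>u = 1\<close>).\<close>

definition threshold :: "real \<Rightarrow> rat \<Rightarrow> rat \<Rightarrow> real" where
  "threshold p u v = real_of_rat u * real_of_rat v powr (1 / p)"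

definition gapsvp_instance :: "rat mat \<Rightarrow> rat \<Rightarrow> rat \<Rightarrow> bool" where
  "gapsvp_instance B u v \<longleftrightarrow>
     0 < dim_col B \<and> is_basis (map_mat real_of_rat B) \<and> 0 < u \<and> 0 < v"

definition GapSVP :: "real \<Rightarrow> promise_problem" where
  "GapSVP p =
    ({enc_gapsvp B u v | B u v. gapsvp_instance B u v \<and>
        lambda1 p (lattice_of (map_mat real_of_rat B)) \<le> threshold p u v},
     {enc_gapsvp B u v | B u v. gapsvp_instance B u v \<and>
        lambda1 p (lattice_of (map_mat real_of_rat B)) > threshold p u v})"

end

theory Submission
  imports Defs
begin

text \<open>
  Let \<open>n\<close> be the number of weights. To coefficients \<open>(x, y)\<close> the lattice assigns the vector with
  entries \<open>x\<^sub>j - y / 2\<close>, \<open>\<Sum>a\<^sub>ix\<^sub>i - s y\<close>, \<open>6/5 (\<Sum>x\<^sub>i) - n y\<close> for each \<open>j < n\<close>; the threshold is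
  \<open>n powr (1/p) / 2\<close>. Repeating the two constraints \<open>n\<close> times replaces a large multiplier: a violated
  constraint alone contributes \<open>n\<close> to the \<open>p\<close>-th power of the norm. Short vectors thus satisfy both
  constraints. If \<open>y = 0\<close>, then \<open>x\<close> witnesses \<open>p\<close>-dependency. Otherwise the numbers
  \<open>x\<^sub>j - y / 2\<close> have the sum \<open>y n / 3\<close>, and bounding \<open>\<bar>w\<bar> powr p\<close> from below by its tangent at
  \<open>\<bar>w\<bar> = 1/2\<close> shows that their absolute values have mean at most \<open>1/2\<close>. Hence \<open>\<bar>y\<bar> = 1\<close>, and \<open>x y\<close> is a
  0-1 solution; conversely, a solution \<open>x\<close> and \<open>y = 1\<close> attain the threshold.

  The program reads its input with total parsers, so that it also halts in polynomial time on strings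
  that are no codes.
\<close>

section \<open>Programs and their running time\<close>

text \<open>An upper bound in place of the exact step count lets estimates be rounded up at every
  composition. Since \<open>exec\<close> is deterministic, it still bounds the actual running
  time.\<close>

definition runs :: "prog \<Rightarrow> store \<Rightarrow> nat \<Rightarrow> store \<Rightarrow> bool" where
  "runs c s n s' \<longleftrightarrow> (\<exists>t\<le>n. exec c s t s')"

text \<open>Besides weakening the bound it exchanges the final store for an equal one. This is how
  chains of function updates written in different orders are reconciled below.\<close>

lemma runs_mono: "runs c s n s' \<Longrightarrow> n \<le> m \<Longrightarrow> s' = s'' \<Longrightarrow> runs c s m s''"
  unfolding runs_def using le_trans by blast

lemma runs_Skip: "runs Skip s 1 s"
  unfolding runs_def using exec.Skip by blast

lemma runs_Push: "runs (Push r b) s 1 (s(r := b # s r))"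
  unfolding runs_def using exec.Push by blast

lemma runs_Pop: "runs (Pop r) s 1 (s(r := tl (s r)))"
  unfolding runs_def using exec.Pop by blast

lemma runs_Seq: "runs c s m s' \<Longrightarrow> runs d s' n s'' \<Longrightarrow> runs (Seq c d) s (m + n) s''"
  unfolding runs_def using exec.Seq by (meson add_mono)

lemma runs_Branch_Nil: "s r = [] \<Longrightarrow> runs c s n s' \<Longrightarrow> runs (Branch r c c1 c2) s (Suc n) s'"
  unfolding runs_def using exec.Branch_Nil by (meson Suc_le_mono)

lemma runs_Branch_Cons:
  "s r = b # w \<Longrightarrow> runs (if b then c2 else c1) s n s' \<Longrightarrow> runs (Branch r c c1 c2) s (Suc n) s'"
  unfolding runs_def using exec.Branch_False exec.Branch_True
  by (cases b) (metis (full_types) Suc_le_mono)+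

lemma runs_While_Nil: "s r = [] \<Longrightarrow> runs (While r c) s 1 s"
  unfolding runs_def using exec.While_Nil by blast

lemma runs_While_Cons:
  "s r \<noteq> [] \<Longrightarrow> runs c s m s' \<Longrightarrow> runs (While r c) s' n s'' \<Longrightarrow>
    runs (While r c) s (Suc (m + n)) s''"
  unfolding runs_def using exec.While_Cons by (meson Suc_le_mono add_mono)

text \<open>One step pushes at most one bit. The output length is later read off from the running
  time in this way.\<close>

lemma runs_length: "runs c s n s' \<Longrightarrow> length (s' r) \<le> length (s r) + n"
proof -
  have "exec c s t s' \<Longrightarrow> length (s' r) \<le> length (s r) + t" for t
    by (induction rule: exec.induct) auto
  then show "runs c s n s' \<Longrightarrow> ?thesis"
    unfolding runs_def by (meson add_left_mono le_trans)
qed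

section \<open>Loops over the bits of a stack\<close>

definition each :: "nat \<Rightarrow> (bool \<Rightarrow> prog) \<Rightarrow> prog" where
  "each r g = While r (Branch r Skip (Seq (Pop r) (g False)) (Seq (Pop r) (g True)))"

text \<open>\<open>\<sigma> us\<close> is the store after the bits \<open>us\<close> have been popped from stack \<open>r\<close>
  and processed, up to the content of \<open>r\<close>.\<close>

lemma runs_each:
  assumes step: "\<And>b us vs. xs = us @ b # vs \<Longrightarrow>
      runs (g b) ((\<sigma> us)(r := vs)) m ((\<sigma> (us @ [b]))(r := vs))"
    and s: "s = (\<sigma> [])(r := xs)" and s': "s' = (\<sigma> xs)(r := [])"
    and n: "(m + 3) * length xs + 1 \<le> n"
  shows "runs (each r g) s n s'"
proof -
  \<comment> \<open>Each round costs \<open>m\<close> plus one step each for the loop test, the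
    branch and the pop.\<close>
  have "runs (each r g) ((\<sigma> us)(r := vs)) ((m + 3) * length vs + 1) ((\<sigma> xs)(r := []))"
    if "xs = us @ vs" for us vs
    using that
  proof (induction vs arbitrary: us)
    case Nil
    then show ?case by (simp add: each_def runs_While_Nil[simplified])
  next
    case (Cons b vs)
    have pop: "((\<sigma> us)(r := b # vs))(r := tl (((\<sigma> us)(r := b # vs)) r)) = (\<sigma> us)(r := vs)"
      by simp
    have "runs (Seq (Pop r) (g b)) ((\<sigma> us)(r := b # vs)) (1 + m) ((\<sigma> (us @ [b]))(r := vs))"
      using runs_Seq[OF runs_Pop[of r "(\<sigma> us)(r := b # vs)", unfolded pop] step[OF Cons.prems]] .
    then have 1: "runs (Branch r Skip (Seq (Pop r) (g False)) (Seq (Pop r) (g True)))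
        ((\<sigma> us)(r := b # vs)) (Suc (1 + m)) ((\<sigma> (us @ [b]))(r := vs))"
      by (intro runs_Branch_Cons[where b = b and w = vs]) (auto split: if_split)
    have 2: "runs (each r g) ((\<sigma> (us @ [b]))(r := vs)) ((m + 3) * length vs + 1) ((\<sigma> xs)(r := []))"
      using Cons.prems by (intro Cons.IH) simp
    show ?case
      unfolding each_def by (rule runs_mono[OF runs_While_Cons[OF _ 1 2[unfolded each_def]]]) auto
  qed
  from this[of "[]" xs] show ?thesis using n unfolding s s' by (auto intro: runs_mono)
qed

definition clear :: "nat \<Rightarrow> prog" where
  "clear r = each r (\<lambda>b. Skip)"

lemma runs_clear: "runs (clear r) s (4 * length (s r) + 1) (s(r := []))"
  unfolding clear_def
  by (rule runs_each[where \<sigma> = "\<lambda>us. s" and m = 1 and xs = "s r"]) (simp_all add: runs_Skip[simplified])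

definition move :: "nat \<Rightarrow> nat \<Rightarrow> prog" where
  "move x y = each x (Push y)"

lemma runs_move:
  assumes "x \<noteq> y"
  shows "runs (move x y) s (4 * length (s x) + 1) (s(x := [], y := rev (s x) @ s y))"
  unfolding move_def
  by (rule runs_each[where \<sigma> = "\<lambda>us. s(y := rev us @ s y)" and m = 1 and xs = "s x"])
    (use assms in \<open>auto intro!: runs_mono[OF runs_Push] simp: fun_eq_iff\<close>)

fun pushes :: "nat \<Rightarrow> bool list \<Rightarrow> prog" where
  "pushes r [] = Skip"
| "pushes r (b # bs) = Seq (Push r b) (pushes r bs)"

lemma runs_pushes: "runs (pushes r bs) s (length bs + 1) (s(r := rev bs @ s r))"
proof (induction bs arbitrary: s)
  case Nil
  then show ?case using runs_Skip[of s] by simp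
next
  case (Cons b bs)
  show ?case
    unfolding pushes.simps
    by (rule runs_mono[OF runs_Seq[OF runs_Push Cons.IH]]) (auto simp: fun_eq_iff)
qed

abbreviation enc_bits :: "bool list \<Rightarrow> bool list" where
  "enc_bits \<equiv> enc_list (\<lambda>b. [b])"

text \<open>The output is written to stack 9 in reverse. Stack 2 is a scratch stack, empty between
  the subprograms.\<close>

definition emit :: "nat \<Rightarrow> prog" where
  "emit r = Seq (each r (\<lambda>b. Seq (Push 2 b) (pushes 9 [True, b])))
     (Seq (Push 9 False) (move 2 r))"

lemma enc_list_conv: "enc_list e xs = concat (map (\<lambda>x. True # e x) xs) @ [False]"
  by (induction xs) simp_all

lemma runs_emit:
  assumes "r \<noteq> 2" "r \<noteq> 9" "s 2 = []"
  shows "runs (emit r) s (11 * length (s r) + 3) (s(9 := rev (enc_bits (s r)) @ s 9))"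
proof -
  have 1: "runs (each r (\<lambda>b. Seq (Push 2 b) (pushes 9 [True, b]))) s (7 * length (s r) + 1)
      (s(2 := rev (s r), 9 := rev (concat (map (\<lambda>b. [True, b]) (s r))) @ s 9, r := []))"
    by (rule runs_each[where m = 4 and xs = "s r" and
          \<sigma> = "\<lambda>us. s(2 := rev us, 9 := rev (concat (map (\<lambda>b. [True, b]) us)) @ s 9)"])
      (use assms in \<open>auto intro!: runs_mono[OF runs_Seq[OF runs_Push runs_pushes]]
        simp: fun_eq_iff simp del: pushes.simps\<close>)
  show ?thesis unfolding emit_def
    by (rule runs_mono[OF runs_Seq[OF 1 runs_Seq[OF runs_Push runs_move]]])
      (use assms in \<open>auto simp: fun_eq_iff enc_list_conv\<close>)
qed

text \<open>Stack \<open>r\<close> serves as a unary counter. Its bits are kept on stack 10 and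
  moved back, so that the counter survives the loop.\<close>

definition for_each :: "nat \<Rightarrow> prog \<Rightarrow> prog" where
  "for_each r c = Seq (each r (\<lambda>b. Seq (Push 10 b) c)) (move 10 r)"

text \<open>The premise on \<open>c\<close> ranges over all stores that agree with \<open>s\<close>
  outside \<open>r\<close>, 9 and 10, because these three stacks change while the loop is under
  way.\<close>

lemma runs_for_each:
  assumes "r \<noteq> 9" "r \<noteq> 10" "s 10 = []"
    and c: "\<And>s'. (\<And>k. k \<notin> {r, 9, 10} \<Longrightarrow> s' k = s k) \<Longrightarrow> runs c s' m (s'(9 := ys @ s' 9))"
  shows "runs (for_each r c) s ((m + 8) * length (s r) + 2)
    (s(9 := concat (replicate (length (s r)) ys) @ s 9))"
proof -
  have 1: "runs (each r (\<lambda>b. Seq (Push 10 b) c)) s ((Suc m + 3) * length (s r) + 1)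
      (s(10 := rev (s r), 9 := concat (replicate (length (s r)) ys) @ s 9, r := []))"
  proof (rule runs_each[where m = "Suc m" and xs = "s r" and
        \<sigma> = "\<lambda>us. s(10 := rev us, 9 := concat (replicate (length us) ys) @ s 9)"])
    fix b us vs
    show "runs (Seq (Push 10 b) c)
        (s(10 := rev us, 9 := concat (replicate (length us) ys) @ s 9, r := vs)) (Suc m)
        (s(10 := rev (us @ [b]), 9 := concat (replicate (length (us @ [b])) ys) @ s 9, r := vs))"
      by (rule runs_mono[OF runs_Seq[OF runs_Push c]]) (use assms(1,2) in \<open>auto simp: fun_eq_iff\<close>)
  qed (use assms in \<open>auto simp: fun_eq_iff\<close>)
  show ?thesis unfolding for_each_def
    by (rule runs_mono[OF runs_Seq[OF 1 runs_move]])
      (use assms in \<open>auto simp: fun_eq_iff algebra_simps\<close>)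
qed

section \<open>Counting in binary and total parsing of the input\<close>

fun inc :: "bool list \<Rightarrow> bool list" where
  "inc [] = [True]"
| "inc (False # xs) = True # xs"
| "inc (True # xs) = False # inc xs"

lemma bits_Suc: "bits (Suc n) = inc (bits n)"
proof (induction n rule: less_induct)
  case (less n)
  show ?case
  proof (cases "even n")
    case True
    then show ?thesis
      by (cases "n = 0") (simp_all add: bits.simps[of "Suc n"] bits.simps[of "Suc 0"] bits.simps[of n] bits.simps[of 0])
  next
    case False
    then have "n \<noteq> 0" by (cases n) auto
    moreover from this have "n div 2 < n" by simp
    moreover have "Suc n div 2 = Suc (n div 2)" using False by presburger
    ultimately show ?thesis
      using False less by (simp add: bits.simps[of "Suc n"] bits.simps[of n] odd_pos)
  qed
qed

lemma length_inc: "length (inc xs) \<le> Suc (length xs)"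
  by (induction xs rule: inc.induct) auto

text \<open>Far from the logarithmic truth, but enough here: it is applied to the number of weights,
  which is at most the input length.\<close>

lemma length_bits: "length (bits n) \<le> n"
proof (induction n)
  case 0
  then show ?case by (simp add: bits.simps)
next
  case (Suc n)
  then show ?case using length_inc[of "bits n"] by (simp add: bits_Suc)
qed

text \<open>Stack 3 is a flag that stays up while there is a carry. The low-order bits that the
  carry turns into \<open>False\<close> wait on stack 2 and are put back at the end.\<close>

definition increment :: "nat \<Rightarrow> prog" where
  "increment r = Seq (Push 3 True) (Seq
     (While 3 (Branch r (Seq (Push r True) (Pop 3))
       (Seq (Pop r) (Seq (Push r True) (Pop 3)))
       (Seq (Pop r) (Push 2 False))))
     (move 2 r))"

lemma runs_increment:
  assumes r: "r \<noteq> 2" "r \<noteq> 3" and s: "s 2 = []" "s 3 = []"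
  shows "runs (increment r) s (8 * length (s r) + 10) (s(r := inc (s r)))"
proof -
  let ?c = "Branch r (Seq (Push r True) (Pop 3)) (Seq (Pop r) (Seq (Push r True) (Pop 3)))
    (Seq (Pop r) (Push 2 False))"
  \<comment> \<open>Invariant: the bits waiting on stack 2, put back on the rest, give the
    incremented number with \<open>ts\<close> below it. The length bound pays for moving them
    back.\<close>
  have loop: "\<exists>xs' ts'. rev ts' @ xs' = rev ts @ inc xs \<and> length ts' \<le> length ts + length xs \<and>
      runs (While 3 ?c) (s(r := xs, 2 := ts, 3 := [True])) (4 * length xs + 6)
        (s(r := xs', 2 := ts', 3 := []))" for xs ts
  proof (induction xs arbitrary: ts rule: inc.induct)
    case 1
    have "runs (While 3 ?c) (s(r := [], 2 := ts, 3 := [True])) (Suc (Suc (1 + 1) + 1))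
        (s(r := [True], 2 := ts, 3 := []))"
      by (rule runs_mono, rule runs_While_Cons[OF _ runs_Branch_Nil[OF _ runs_Seq[OF runs_Push runs_Pop]]
            runs_While_Nil]) (use r in \<open>auto simp: fun_eq_iff\<close>)
    then have "runs (While 3 ?c) (s(r := [], 2 := ts, 3 := [True])) (4 * length [] + 6)
        (s(r := [True], 2 := ts, 3 := []))" by (rule runs_mono) simp_all
    moreover have "rev ts @ [True] = rev ts @ inc []" "length ts \<le> length ts + length ([] :: bool list)"
      by simp_all
    ultimately show ?case by blast
  next
    case (2 xs)
    have 1: "runs ?c (s(r := False # xs, 2 := ts, 3 := [True])) 4 (s(r := True # xs, 2 := ts, 3 := []))"
      by (rule runs_mono[OF runs_Branch_Cons[where b = False and w = xs]],
          use r in simp, simp, rule runs_Seq[OF runs_Pop runs_Seq[OF runs_Push runs_Pop]])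
        (use r in \<open>auto simp: fun_eq_iff\<close>)
    have "runs (While 3 ?c) (s(r := False # xs, 2 := ts, 3 := [True])) (4 * length (False # xs) + 6)
        (s(r := True # xs, 2 := ts, 3 := []))"
      by (rule runs_mono[OF runs_While_Cons[OF _ 1 runs_While_Nil]]) auto
    moreover have "rev ts @ True # xs = rev ts @ inc (False # xs)"
      "length ts \<le> length ts + length (False # xs)"
      by simp_all
    ultimately show ?case by blast
  next
    case (3 xs)
    have 1: "runs ?c (s(r := True # xs, 2 := ts, 3 := [True])) 3 (s(r := xs, 2 := False # ts, 3 := [True]))"
      by (rule runs_mono[OF runs_Branch_Cons[where b = True and w = xs]],
          use r in simp, simp, rule runs_Seq[OF runs_Pop runs_Push])
        (use r in \<open>auto simp: fun_eq_iff\<close>)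
    from 3[of "False # ts"] obtain xs' ts' where
      *: "rev ts' @ xs' = rev (False # ts) @ inc xs" "length ts' \<le> length (False # ts) + length xs"
      and 2: "runs (While 3 ?c) (s(r := xs, 2 := False # ts, 3 := [True])) (4 * length xs + 6)
        (s(r := xs', 2 := ts', 3 := []))" by blast
    have "runs (While 3 ?c) (s(r := True # xs, 2 := ts, 3 := [True])) (4 * length (True # xs) + 6)
        (s(r := xs', 2 := ts', 3 := []))"
      by (rule runs_mono[OF runs_While_Cons[OF _ 1 2]]) auto
    moreover have "rev ts' @ xs' = rev ts @ inc (True # xs)"
      "length ts' \<le> length ts + length (True # xs)"
      using * by simp_all
    ultimately show ?case by blast
  qed
  from loop[of "[]" "s r"] obtain xs' ts' where *: "rev ts' @ xs' = inc (s r)"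
    "length ts' \<le> length (s r)" and
    run: "runs (While 3 ?c) (s(r := s r, 2 := [], 3 := [True])) (4 * length (s r) + 6)
        (s(r := xs', 2 := ts', 3 := []))" by auto
  have "s(r := s r, 2 := [], 3 := [True]) = s(3 := True # s 3)"
    using s by (auto simp: fun_eq_iff)
  note run = run[unfolded this]
  show ?thesis unfolding increment_def
    by (rule runs_mono[OF runs_Seq[OF runs_Push runs_Seq[OF run runs_move]]])
      (use r s * in \<open>auto simp: fun_eq_iff\<close>)
qed

text \<open>On inputs that are not codes the parsers stop at the end of the input.\<close>

fun take_bits :: "bool list \<Rightarrow> bool list" where
  "take_bits (True # b # w) = b # take_bits w"
| "take_bits _ = []"

fun drop_bits :: "bool list \<Rightarrow> bool list" where
  "drop_bits (True # b # w) = drop_bits w"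
| "drop_bits (False # w) = w"
| "drop_bits _ = []"

lemma length_drop_bits: "length (drop_bits w) \<le> length w"
  by (induction w rule: drop_bits.induct) auto

lemma length_take_bits: "length (take_bits w) \<le> length w"
  by (induction w rule: take_bits.induct) auto

lemma take_bits_enc_bits: "take_bits (enc_bits xs @ w) = xs"
  by (induction xs) auto

lemma drop_bits_enc_bits: "drop_bits (enc_bits xs @ w) = w"
  by (induction xs) auto

text \<open>The elements stay bit strings: the reduction only copies the weights and never computes
  with them.\<close>

function take_list :: "bool list \<Rightarrow> bool list list" where
  "take_list (True # w) = take_bits w # take_list (drop_bits w)"
| "take_list (False # w) = []"
| "take_list [] = []"
  by pat_completeness auto
termination
  by (relation "measure length") (simp_all add: less_Suc_eq_le length_drop_bits)

text \<open>Stack 3 is the loop flag, lowered at the end marker or at the end of the input. A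
  \<open>True\<close> without a following bit leaves the flag up; the next round then finds
  \<open>x\<close> empty and stops.\<close>

definition read :: "nat \<Rightarrow> nat \<Rightarrow> prog" where
  "read x y = Seq (Push 3 True) (Seq
     (While 3 (Branch x (Pop 3) (Seq (Pop x) (Pop 3))
       (Seq (Pop x) (Branch x Skip (Seq (Pop x) (Push 2 False)) (Seq (Pop x) (Push 2 True))))))
     (move 2 y))"

lemma runs_read:
  assumes x: "x \<noteq> 2" "x \<noteq> 3" and y: "y \<noteq> 2" "y \<noteq> 3" "x \<noteq> y"
    and s: "s 2 = []" "s 3 = []" "s y = []"
  shows "runs (read x y) s (12 * length (s x) + 10)
    (s(x := drop_bits (s x), y := take_bits (s x)))"
proof -
  let ?c = "Branch x (Pop 3) (Seq (Pop x) (Pop 3))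
       (Seq (Pop x) (Branch x Skip (Seq (Pop x) (Push 2 False)) (Seq (Pop x) (Push 2 True))))"
  have end_of_input: "runs (While 3 ?c) (s(x := [], 2 := ts, 3 := [True])) 4
      (s(x := [], 2 := ts, 3 := []))" for ts
    by (rule runs_mono[OF runs_While_Cons[OF _ runs_Branch_Nil[OF _ runs_Pop] runs_While_Nil]])
      (use x in \<open>auto simp: fun_eq_iff\<close>)
  have loop: "runs (While 3 ?c) (s(x := w, 2 := ts, 3 := [True])) (8 * length w + 8)
      (s(x := drop_bits w, 2 := rev (take_bits w) @ ts, 3 := []))" for w ts
  proof (induction w arbitrary: ts rule: drop_bits.induct)
    case (1 b w)
    have pop: "(s(x := True # b # w, 2 := ts, 3 := [True]))(x := tl ((s(x := True # b # w, 2 := ts, 3 := [True])) x))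
       = s(x := b # w, 2 := ts, 3 := [True])"
      using x by (auto simp: fun_eq_iff)
    have "runs (Seq (Pop x) (Push 2 b)) (s(x := b # w, 2 := ts, 3 := [True])) (1 + 1)
        (s(x := w, 2 := b # ts, 3 := [True]))"
      by (rule runs_mono[OF runs_Seq[OF runs_Pop runs_Push]]) (use x in \<open>auto simp: fun_eq_iff\<close>)
    then have "runs (Branch x Skip (Seq (Pop x) (Push 2 False)) (Seq (Pop x) (Push 2 True)))
        (s(x := b # w, 2 := ts, 3 := [True])) 3 (s(x := w, 2 := b # ts, 3 := [True]))"
      by (intro runs_mono[OF runs_Branch_Cons[where b = b and w = w]]) (use x in \<open>auto split: if_split\<close>)
    from runs_Seq[OF runs_Pop[of x "s(x := True # b # w, 2 := ts, 3 := [True])", unfolded pop] this]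
    have 2: "runs ?c (s(x := True # b # w, 2 := ts, 3 := [True])) 5 (s(x := w, 2 := b # ts, 3 := [True]))"
      by (intro runs_mono[OF runs_Branch_Cons[where b = True and w = "b # w"]]) (use x in auto)
    show ?case
      by (rule runs_mono[OF runs_While_Cons[OF _ 2 1]]) auto
  next
    case (2 w)
    have 1: "runs ?c (s(x := False # w, 2 := ts, 3 := [True])) 3 (s(x := w, 2 := ts, 3 := []))"
      by (rule runs_mono[OF runs_Branch_Cons[where b = False and w = w]],
          use x in simp, simp, rule runs_Seq[OF runs_Pop runs_Pop])
        (use x in \<open>auto simp: fun_eq_iff\<close>)
    show ?case
      by (rule runs_mono[OF runs_While_Cons[OF _ 1 runs_While_Nil]]) auto
  next
    case "3_1"
    show ?case
      by (rule runs_mono[OF end_of_input]) auto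
  next
    case "3_2"
    have 1: "runs ?c (s(x := [True], 2 := ts, 3 := [True])) 4 (s(x := [], 2 := ts, 3 := [True]))"
      by (rule runs_mono[OF runs_Branch_Cons[where b = True and w = "[]"]],
          use x in simp, simp, rule runs_Seq[OF runs_Pop runs_Branch_Nil[OF _ runs_Skip]])
        (use x in \<open>auto simp: fun_eq_iff\<close>)
    show ?case
      by (rule runs_mono[OF runs_While_Cons[OF _ 1 end_of_input]]) auto
  qed
  have "s(x := s x, 2 := [], 3 := [True]) = s(3 := True # s 3)"
    using s by (auto simp: fun_eq_iff)
  note run = loop[of "s x" "[]", unfolded this]
  show ?thesis unfolding read_def
    by (rule runs_mono[OF runs_Seq[OF runs_Push runs_Seq[OF run runs_move]]])
      (use x y s length_take_bits[of "s x"] in \<open>auto simp: fun_eq_iff\<close>)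
qed

text \<open>Stack 11 is the loop flag. The final \<open>clear\<close> discards whatever follows the
  end marker; in particular stack 0 is empty when the output is moved there.\<close>

definition list_loop :: "nat \<Rightarrow> prog \<Rightarrow> prog" where
  "list_loop x c = Seq (Push 11 True) (Seq
     (While 11 (Branch x (Pop 11) (Seq (Pop x) (Pop 11))
       (Seq (Pop x) (Seq (read x 5) c))))
     (clear x))"

text \<open>\<open>\<sigma> k\<close> is the store after \<open>k\<close> rounds, up to
  \<open>x\<close> and the flag; as \<open>\<sigma> k 5\<close> is empty, \<open>c\<close> has to
  clear the element it was given. There are at most \<open>l + 1\<close> rounds, and
  \<open>12 * l + 20\<close> covers the parsing in each of them.\<close>

lemma runs_list_loop:
  assumes x: "x \<notin> {2, 3, 5, 11}"
    and \<sigma>: "\<And>k. \<sigma> k 2 = []" "\<And>k. \<sigma> k 3 = []" "\<And>k. \<sigma> k 5 = []" "\<And>k. \<sigma> k 11 = []"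
    and c: "\<And>k w. k < length (take_list v) \<Longrightarrow>
      runs c ((\<sigma> k)(x := w, 5 := take_list v ! k, 11 := [True])) m ((\<sigma> (Suc k))(x := w, 11 := [True]))"
    and s: "s = (\<sigma> 0)(x := v)" and l: "length v \<le> l"
  shows "runs (list_loop x c) s ((l + 1) * (m + 12 * l + 20) + 4 * l + 2)
    ((\<sigma> (length (take_list v)))(x := []))"
proof -
  let ?c = "Branch x (Pop 11) (Seq (Pop x) (Pop 11)) (Seq (Pop x) (Seq (read x 5) c))"
  \<comment> \<open>\<open>w'\<close> is the part of the input left over when the loop stops. Its
    length is bounded because clearing it takes time.\<close>
  have loop: "\<exists>w'. length w' \<le> length w \<and>
      runs (While 11 ?c) ((\<sigma> k)(x := w, 11 := [True])) ((length w + 1) * (m + 12 * l + 20))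
        ((\<sigma> (length (take_list v)))(x := w', 11 := []))"
    if "k \<le> length (take_list v)" "take_list w = drop k (take_list v)" "length w \<le> l" for w k
    using that
  proof (induction w arbitrary: k rule: take_list.induct)
    case (1 w)
    from "1.prems" have k: "k < length (take_list v)"
      by (cases "k = length (take_list v)") auto
    then have eq: "take_list v ! k = take_bits w" "drop (Suc k) (take_list v) = take_list (drop_bits w)"
      using "1.prems"(2) by (simp_all add: Cons_nth_drop_Suc[symmetric])
    let ?s = "(\<sigma> k)(x := True # w, 11 := [True])"
    have "runs (Seq (Pop x) (Seq (read x 5) c)) ?s (1 + ((12 * length w + 10) + m))
        ((\<sigma> (Suc k))(x := drop_bits w, 11 := [True]))"
    proof (intro runs_Seq)
      show "runs (Pop x) ?s 1 ((\<sigma> k)(x := w, 11 := [True]))"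
        by (rule runs_mono[OF runs_Pop]) (use x in \<open>auto simp: fun_eq_iff\<close>)
      show "runs (read x 5) ((\<sigma> k)(x := w, 11 := [True])) (12 * length w + 10)
          ((\<sigma> k)(x := drop_bits w, 5 := take_list v ! k, 11 := [True]))"
        by (rule runs_mono[OF runs_read]) (use x \<sigma> eq in \<open>auto simp: fun_eq_iff\<close>)
    qed (rule c[OF k])
    then have 1: "runs ?c ?s (Suc (1 + ((12 * length w + 10) + m)))
        ((\<sigma> (Suc k))(x := drop_bits w, 11 := [True]))"
      by (intro runs_Branch_Cons[where b = True and w = w]) (use x in auto)
    have "length (drop_bits w) \<le> l" using "1.prems"(3) length_drop_bits[of w] by simp
    from "1.IH"[OF _ eq(2)[symmetric] this] k obtain w' where
      w': "length w' \<le> length (drop_bits w)" and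
      2: "runs (While 11 ?c) ((\<sigma> (Suc k))(x := drop_bits w, 11 := [True]))
        ((length (drop_bits w) + 1) * (m + 12 * l + 20))
        ((\<sigma> (length (take_list v)))(x := w', 11 := []))" by (meson Suc_leI)
    have "Suc (Suc (1 + ((12 * length w + 10) + m))) + (length (drop_bits w) + 1) * (m + 12 * l + 20)
        \<le> (m + 12 * l + 20) + (length w + 1) * (m + 12 * l + 20)"
      using "1.prems"(3) length_drop_bits[of w]
      by (intro add_mono mult_le_mono1) simp_all
    moreover have "runs (While 11 ?c) ?s
        (Suc (Suc (1 + ((12 * length w + 10) + m)) + (length (drop_bits w) + 1) * (m + 12 * l + 20)))
        ((\<sigma> (length (take_list v)))(x := w', 11 := []))"
      by (rule runs_While_Cons[OF _ 1 2]) simp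
    ultimately have "runs (While 11 ?c) ?s ((length (True # w) + 1) * (m + 12 * l + 20))
        ((\<sigma> (length (take_list v)))(x := w', 11 := []))"
      by (elim runs_mono) simp_all
    moreover have "length w' \<le> length (True # w)" using w' length_drop_bits[of w] by simp
    ultimately show ?case by blast
  next
    case (2 w)
    then have k: "k = length (take_list v)" by simp
    have 1: "runs ?c ((\<sigma> k)(x := False # w, 11 := [True])) 3 ((\<sigma> k)(x := w, 11 := []))"
      by (rule runs_mono[OF runs_Branch_Cons[where b = False and w = w]],
          use x in simp, simp, rule runs_Seq[OF runs_Pop runs_Pop])
        (use x in \<open>auto simp: fun_eq_iff\<close>)
    have "runs (While 11 ?c) ((\<sigma> k)(x := False # w, 11 := [True]))
        ((length (False # w) + 1) * (m + 12 * l + 20)) ((\<sigma> k)(x := w, 11 := []))"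
      by (rule runs_mono[OF runs_While_Cons[OF _ 1 runs_While_Nil]]) auto
    moreover have "length w \<le> length (False # w)" by simp
    ultimately show ?case unfolding k by blast
  next
    case 3
    then have k: "k = length (take_list v)" by simp
    have "runs (While 11 ?c) ((\<sigma> k)(x := [], 11 := [True]))
        ((length ([] :: bool list) + 1) * (m + 12 * l + 20)) ((\<sigma> k)(x := [], 11 := []))"
      by (rule runs_mono[OF runs_While_Cons[OF _ runs_Branch_Nil[OF _ runs_Pop] runs_While_Nil]])
        (use x in auto)
    then show ?case unfolding k by blast
  qed
  from loop[of 0 v] l obtain w' where w': "length w' \<le> length v" and
    run: "runs (While 11 ?c) ((\<sigma> 0)(x := v, 11 := [True])) ((length v + 1) * (m + 12 * l + 20))
        ((\<sigma> (length (take_list v)))(x := w', 11 := []))" by auto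
  have "length v * (m + 12 * l + 20) \<le> l * (m + 12 * l + 20)"
    using l by (intro mult_le_mono1) simp
  with w' l have time: "length v * (m + 12 * l + 20) + 4 * length w' \<le> 4 * l + l * (m + 12 * l + 20)"
    by linarith
  have "(\<sigma> 0)(x := v, 11 := [True]) = s(11 := True # s 11)"
    using \<sigma> x unfolding s by (auto simp: fun_eq_iff)
  note run = run[unfolded this]
  show ?thesis unfolding list_loop_def
    by (rule runs_mono[OF runs_Seq[OF runs_Push runs_Seq[OF run runs_clear]]])
      (use x time \<sigma> in \<open>auto simp: fun_eq_iff\<close>)
qed

section \<open>A program that writes the lattice basis\<close>

text \<open>One block is a triple of list elements. The middle one spells out the code of a natural
  number with digits \<open>bs\<close>: the sign \<open>False\<close>, the digits, the denominator
  1.\<close>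

definition weight_entries :: "rat \<Rightarrow> bool list \<Rightarrow> bool list" where
  "weight_entries d bs =
     True # enc_rat d @ True # False # enc_bits bs @ enc_int 1 @ True # enc_rat (6 / 5)"

text \<open>The sign bits \<open>True\<close> of the last two numbers are hard-wired. They are right
  for negative numbers, and on instances the sum and the number of weights are positive.\<close>

definition target_entries :: "bool list \<Rightarrow> bool list \<Rightarrow> bool list" where
  "target_entries sum_bits num_bits =
     True # enc_rat (- 1 / 2) @ True # True # enc_bits sum_bits @ enc_int 1 @
       True # True # enc_bits num_bits @ enc_int 1"

definition weight_column :: "nat \<Rightarrow> nat \<Rightarrow> bool list \<Rightarrow> bool list" where
  "weight_column n i bs =
     concat (map (\<lambda>j. weight_entries (if j = i then 1 else 0) bs) [0..<n]) @ [False]"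

definition target_column :: "nat \<Rightarrow> bool list \<Rightarrow> bool list \<Rightarrow> bool list" where
  "target_column n sum_bits num_bits = concat (replicate n (target_entries sum_bits num_bits)) @ [False]"

text \<open>Total on bit strings, as \<open>poly_time\<close> demands. The prefix encodes
  \<open>u = 1 / 2\<close> and \<open>v = n\<close>, that is, the threshold
  \<open>n powr (1 / p) / 2\<close>.\<close>

definition reduction :: "bool list \<Rightarrow> bool list" where
  "reduction w = (let sum_bits = take_bits w; ws = take_list (drop_bits w); n = length ws in
     enc_rat (1 / 2) @ False # enc_bits (bits n) @ enc_int 1 @
     concat (map (\<lambda>i. True # weight_column n i (ws ! i)) [0..<n]) @
     True # target_column n sum_bits (bits n) @ [False])"

lemma enc_rat_Fract:
  assumes "0 < b" "coprime a b"
  shows "enc_rat (Rat.Fract a b) = enc_int a @ enc_int b"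
  using assms by (simp add: enc_rat_def quotient_of_Fract normalize_stable)

lemma enc_rat_of_int: "enc_rat (of_int k) = enc_int k @ enc_int 1"
  using enc_rat_Fract[of 1 k] by (simp add: Rat.Fract_of_int_eq)

lemma enc_rat_divide:
  "enc_rat (1 / 2) = enc_int 1 @ enc_int 2"
  "enc_rat (- 1 / 2) = enc_int (- 1) @ enc_int 2"
  "enc_rat (6 / 5) = enc_int 6 @ enc_int 5"
proof -
  show "enc_rat (1 / 2) = enc_int 1 @ enc_int 2"
    using enc_rat_Fract[of 2 1] by (simp add: Fract_of_int_quotient)
  show "enc_rat (- 1 / 2) = enc_int (- 1) @ enc_int 2"
    using enc_rat_Fract[of 2 "- 1"] by (simp add: Fract_of_int_quotient)
  have "coprime 6 (5 :: int)" using coprime_add_one_left[of "5 :: int"] by simp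
  then show "enc_rat (6 / 5) = enc_int 6 @ enc_int 5"
    using enc_rat_Fract[of 5 6] by (simp add: Fract_of_int_quotient)
qed

lemma length_enc_const:
  "length (enc_rat 0) = 6" "length (enc_rat 1) = 8" "length (enc_rat (1 / 2)) = 10"
  "length (enc_rat (- 1 / 2)) = 10" "length (enc_rat (6 / 5)) = 16" "length (enc_int 1) = 4"
proof -
  have bits: "bits 0 = []" "bits (Suc 0) = [True]" "bits 2 = [False, True]" "bits 3 = [True, True]"
    "bits 6 = [False, True, True]" "bits 5 = [True, False, True]"
    by (simp_all add: bits.simps[of 0] bits.simps[of "Suc 0"] bits.simps[of 2] bits.simps[of 3]
        bits.simps[of 6] bits.simps[of 5])
  show "length (enc_rat 0) = 6" "length (enc_rat 1) = 8"
    using enc_rat_of_int[of 0] enc_rat_of_int[of 1]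
    by (simp_all add: enc_int_def enc_nat_def bits)
  show "length (enc_rat (1 / 2)) = 10"
    "length (enc_rat (- 1 / 2)) = 10" "length (enc_rat (6 / 5)) = 16" "length (enc_int 1) = 4"
    unfolding enc_rat_divide by (simp_all add: enc_int_def enc_nat_def bits)
qed

section \<open>Programs for single blocks and columns\<close>

text \<open>The code of \<open>d\<close> is a constant of the program text, so no rational
  arithmetic takes place at run time.\<close>

definition put_weight_entries :: "rat \<Rightarrow> prog" where
  "put_weight_entries d = Seq (pushes 9 (True # enc_rat d @ [True, False])) (Seq (emit 5)
     (pushes 9 (enc_int 1 @ True # enc_rat (6 / 5))))"

definition put_target_entries :: prog where
  "put_target_entries = Seq (pushes 9 (True # enc_rat (- 1 / 2) @ [True, True])) (Seq (emit 4)
     (Seq (pushes 9 (enc_int 1 @ [True, True])) (Seq (emit 6) (pushes 9 (enc_int 1)))))"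

lemma runs_put_weight_entries:
  assumes "d \<in> {0, 1}" "s 2 = []"
  shows "runs (put_weight_entries d) s (11 * length (s 5) + 40) (s(9 := rev (weight_entries d (s 5)) @ s 9))"
  unfolding put_weight_entries_def
  by (rule runs_mono[OF runs_Seq[OF runs_pushes runs_Seq[OF runs_emit runs_pushes]]])
    (use assms in \<open>auto simp: fun_eq_iff weight_entries_def length_enc_const\<close>)

lemma runs_put_target_entries:
  assumes "s 2 = []"
  shows "runs put_target_entries s (11 * length (s 4) + 11 * length (s 6) + 40)
    (s(9 := rev (target_entries (s 4) (s 6)) @ s 9))"
  unfolding put_target_entries_def
  by (rule runs_mono[OF runs_Seq[OF runs_pushes runs_Seq[OF runs_emit
          runs_Seq[OF runs_pushes runs_Seq[OF runs_emit runs_pushes]]]]])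
    (use assms in \<open>auto simp: fun_eq_iff target_entries_def length_enc_const length_enc_const[simplified]\<close>)

text \<open>The lengths of stacks 7 and 8 are the numbers of weights that have been processed and that
  remain; stack 5 contains the current weight.\<close>

definition put_weight_column :: prog where
  "put_weight_column = Seq (Push 9 True) (Seq (Pop 8) (Seq (for_each 7 (put_weight_entries 0))
     (Seq (put_weight_entries 1) (Seq (for_each 8 (put_weight_entries 0))
       (Seq (Push 9 False) (Seq (Push 7 True) (clear 5)))))))"

text \<open>Splits the column at the diagonal block, which is the order in which the two loops and
  the single block of the program write it.\<close>

lemma weight_column_conv:
  assumes "i < n"
  shows "weight_column n i bs = concat (replicate i (weight_entries 0 bs)) @ weight_entries 1 bs @
    concat (replicate (n - Suc i) (weight_entries 0 bs)) @ [False]"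
proof -
  have "[0..<n] = [0..<i] @ i # [Suc i..<n]"
    using assms by (metis le_add_diff_inverse less_imp_le_nat upt_add_eq_append upt_conv_Cons zero_le)
  moreover have "map (\<lambda>j. weight_entries (if j = i then 1 else 0) bs) [0..<i] =
      replicate i (weight_entries 0 bs)"
    by (rule nth_equalityI) auto
  moreover have "map (\<lambda>j. weight_entries (if j = i then 1 else 0) bs) [Suc i..<n] =
      replicate (n - Suc i) (weight_entries 0 bs)"
    by (rule nth_equalityI) auto
  ultimately show ?thesis by (simp add: weight_column_def)
qed

lemma rev_concat_replicate: "rev (concat (replicate n xs)) = concat (replicate n (rev xs))"
  by (simp add: rev_concat)

lemma runs_put_weight_column:
  assumes s: "s 2 = []" "s 10 = []" "length (s 8) = n - length (s 7)" and i: "length (s 7) < n"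
    and l: "length (s 5) \<le> l"
  shows "runs put_weight_column s ((11 * l + 48) * n + 4 * l + 9)
    (s(5 := [], 7 := True # s 7, 8 := tl (s 8),
       9 := rev (True # weight_column n (length (s 7)) (s 5)) @ s 9))"
proof -
  let ?c = "\<lambda>d. put_weight_entries d"
  have zeros: "runs (for_each r (?c 0)) u ((11 * l + 48) * length (u r) + 2)
      (u(9 := concat (replicate (length (u r)) (rev (weight_entries 0 (s 5)))) @ u 9))"
    if "r \<in> {7, 8}" "u 2 = []" "u 10 = []" "u 5 = s 5" for r u
  proof -
    have "runs (for_each r (?c 0)) u ((11 * l + 40 + 8) * length (u r) + 2)
      (u(9 := concat (replicate (length (u r)) (rev (weight_entries 0 (s 5)))) @ u 9))"
    proof (rule runs_for_each)
      fix v assume v: "\<And>k. k \<notin> {r, 9, 10} \<Longrightarrow> v k = u k"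
      then have "v 2 = []" "v 5 = s 5" using that by auto
      then show "runs (?c 0) v (11 * l + 40) (v(9 := rev (weight_entries 0 (s 5)) @ v 9))"
        using l by (intro runs_mono[OF runs_put_weight_entries]) auto
    qed (use that in auto)
    then show ?thesis by (rule runs_mono) simp_all
  qed
  \<comment> \<open>The diagonal block is charged like one round of a loop, so that the cost becomes
    that of \<open>n\<close> equal blocks.\<close>
  have n: "(11 * l + 48) * length (s 7) + (11 * l + 48) + (11 * l + 48) * (n - Suc (length (s 7)))
      = (11 * l + 48) * n"
    using i by (metis Suc_diff_Suc add.assoc add_mult_distrib2 le_add_diff_inverse less_imp_le_nat
        mult_Suc_right)
  show ?thesis
    unfolding put_weight_column_def
    by (rule runs_mono[OF runs_Seq[OF runs_Push runs_Seq[OF runs_Pop runs_Seq[OF zeros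
            runs_Seq[OF runs_put_weight_entries runs_Seq[OF zeros
              runs_Seq[OF runs_Push runs_Seq[OF runs_Push runs_clear]]]]]]]])
      (use s l n weight_column_conv[OF i, of "s 5"] in \<open>auto simp: fun_eq_iff rev_concat_replicate\<close>)
qed

section \<open>The complete program and its running time\<close>

text \<open>The weights are parsed twice: their number has to be known before the threshold and the
  first column are written.\<close>

definition copy :: prog where
  "copy = Seq (move 0 2) (each 2 (\<lambda>b. Seq (Push 0 b) (Push 1 b)))"

lemma runs_copy:
  assumes "s 1 = []" "s 2 = []"
  shows "runs copy s (9 * length (s 0) + 2) (s(1 := s 0))"
proof -
  let ?s = "s(0 := [], 2 := rev (s 0))"
  have 1: "runs (each 2 (\<lambda>b. Seq (Push 0 b) (Push 1 b))) ?s (5 * length (s 0) + 1) (s(1 := s 0))"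
    by (rule runs_each[where m = 2 and xs = "rev (s 0)" and \<sigma> = "\<lambda>us. s(0 := rev us, 1 := rev us)"])
      (use assms in \<open>auto intro!: runs_mono[OF runs_Seq[OF runs_Push runs_Push]] simp: fun_eq_iff\<close>)
  have 2: "runs (move 0 2) s (4 * length (s 0) + 1) ?s"
    by (rule runs_mono[OF runs_move]) (use assms in \<open>auto simp: fun_eq_iff\<close>)
  show ?thesis
    unfolding copy_def by (rule runs_mono[OF runs_Seq[OF 2 1]]) simp_all
qed

text \<open>The number of weights is kept in binary on stack 6, for printing, and in unary on stack
  8, as a loop counter.\<close>

definition count_weights :: prog where
  "count_weights = list_loop 1 (Seq (increment 6) (Seq (Push 8 True) (clear 5)))"

lemma length_take_list_nth: "k < length (take_list w) \<Longrightarrow> length (take_list w ! k) \<le> length w"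
proof (induction w arbitrary: k rule: take_list.induct)
  case (1 w)
  then show ?case
    using length_take_bits[of w] length_drop_bits[of w] by (cases k) (auto intro: le_trans le_SucI)
qed simp_all

lemma length_take_list: "length (take_list w) \<le> length w"
proof (induction w rule: take_list.induct)
  case (1 w)
  then show ?case using length_drop_bits[of w] by simp
qed simp_all

lemma runs_count_weights:
  assumes s: "s 2 = []" "s 3 = []" "s 5 = []" "s 6 = []" "s 8 = []" "s 11 = []"
    and l: "length (s 1) \<le> l"
  shows "runs count_weights s ((l + 1) * (24 * l + 32) + 4 * l + 2)
    (s(1 := [], 6 := bits (length (take_list (s 1))), 8 := replicate (length (take_list (s 1))) True))"
proof -
  let ?\<sigma> = "\<lambda>k. s(6 := bits k, 8 := replicate k True)"
  have "runs count_weights s ((l + 1) * (12 * l + 12 + 12 * l + 20) + 4 * l + 2)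
    ((?\<sigma> (length (take_list (s 1))))(1 := []))"
    unfolding count_weights_def
  proof (rule runs_list_loop)
    fix k w assume k: "k < length (take_list (s 1))"
    then have "k \<le> l" "length (take_list (s 1) ! k) \<le> l"
      using length_take_list[of "s 1"] length_take_list_nth[OF k] l by auto
    then have "8 * length (bits k) + 10 + (1 + (4 * length (take_list (s 1) ! k) + 1)) \<le> 12 * l + 12"
      using length_bits[of k] by linarith
    then show "runs (Seq (increment 6) (Seq (Push 8 True) (clear 5)))
        ((?\<sigma> k)(1 := w, 5 := take_list (s 1) ! k, 11 := [True])) (12 * l + 12)
        ((?\<sigma> (Suc k))(1 := w, 11 := [True]))"
      by (intro runs_mono[OF runs_Seq[OF runs_increment runs_Seq[OF runs_Push runs_clear]]])
        (use s in \<open>auto simp: fun_eq_iff bits_Suc\<close>)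
  qed (use s l in \<open>auto simp: fun_eq_iff bits.simps\<close>)
  then show ?thesis by (rule runs_mono) (auto simp: fun_eq_iff)
qed

definition put_weight_columns :: prog where
  "put_weight_columns = list_loop 0 put_weight_column"

lemma runs_put_weight_columns:
  assumes s: "s 2 = []" "s 3 = []" "s 5 = []" "s 7 = []" "s 10 = []" "s 11 = []"
    and n: "n = length (take_list (s 0))" "s 8 = replicate n True" and l: "length (s 0) \<le> l"
  shows "runs put_weight_columns s ((l + 1) * ((11 * l + 48) * l + 16 * l + 29) + 4 * l + 2)
    (s(0 := [], 7 := replicate n True, 8 := [],
       9 := rev (concat (map (\<lambda>i. True # weight_column n i (take_list (s 0) ! i)) [0..<n])) @ s 9))"
proof -
  let ?c = "\<lambda>i. True # weight_column n i (take_list (s 0) ! i)"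
  let ?\<sigma> = "\<lambda>k. s(7 := replicate k True, 8 := replicate (n - k) True,
    9 := rev (concat (map ?c [0..<k])) @ s 9)"
  have "runs put_weight_columns s
    ((l + 1) * (((11 * l + 48) * l + 4 * l + 9) + 12 * l + 20) + 4 * l + 2)
    ((?\<sigma> (length (take_list (s 0))))(0 := []))"
    unfolding put_weight_columns_def
  proof (rule runs_list_loop)
    fix k w assume k: "k < length (take_list (s 0))"
    then have k': "k < n" "length (take_list (s 0) ! k) \<le> l" "n \<le> l"
      using length_take_list[of "s 0"] length_take_list_nth[OF k] l n by auto
    then have "(11 * l + 48) * n \<le> (11 * l + 48) * l" by simp
    then show "runs put_weight_column
        ((?\<sigma> k)(0 := w, 5 := take_list (s 0) ! k, 11 := [True]))
        ((11 * l + 48) * l + 4 * l + 9) ((?\<sigma> (Suc k))(0 := w, 11 := [True]))"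
      by (intro runs_mono[OF runs_put_weight_column[of _ n l]])
        (use s k' in \<open>auto simp: fun_eq_iff tl_replicate\<close>)
  qed (use s l n in \<open>auto simp: fun_eq_iff\<close>)
  then show ?thesis by (rule runs_mono) (auto simp: fun_eq_iff n algebra_simps)
qed

text \<open>Stack 4 holds the bits of the target sum, stack 0 the weights and stack 1 their copy for
  counting. The weight columns leave the unary \<open>n\<close> on stack 7, where it drives the loop
  for the last column. The final move also undoes the reversal of the output.\<close>

definition reduction_prog :: prog where
  "reduction_prog = Seq
     (Seq (read 0 4) (Seq copy (Seq count_weights
       (Seq (Seq (pushes 9 (enc_rat (1 / 2) @ [False])) (Seq (emit 6) (pushes 9 (enc_int 1))))
       (Seq put_weight_columns
       (Seq (Push 9 True) (Seq (for_each 7 put_target_entries) (pushes 9 [False, False]))))))))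
     (move 9 0)"

text \<open>Cubic growth comes from at most \<open>l\<close> columns of at most \<open>l\<close>
  blocks, each written in time linear in \<open>l\<close>.\<close>

lemma runs_reduction_prog:
  "\<exists>s. runs reduction_prog ((\<lambda>_. [])(0 := w)) (1000 * (length w + 1) ^ 3) s \<and> s 0 = reduction w"
proof -
  define l where "l = length w"
  define v where "v = drop_bits w"
  define n where "n = length (take_list v)"
  define bs where "bs = take_bits w"
  define hd where "hd = enc_rat (1 / 2) @ False # enc_bits (bits n) @ enc_int 1"
  define cs where "cs = concat (map (\<lambda>i. True # weight_column n i (take_list v ! i)) [0..<n])"
  define ts where "ts = concat (replicate n (target_entries bs (bits n)))"
  have v: "length v \<le> l" unfolding v_def l_def by (rule length_drop_bits)
  have n: "n \<le> l" using length_take_list[of v] v unfolding n_def by simp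
  have bs: "length bs \<le> l" unfolding bs_def l_def by (rule length_take_bits)
  let ?e = "(\<lambda>_. []) :: store"
  let ?s1 = "?e(0 := v, 4 := bs)"
  let ?s2 = "?e(0 := v, 1 := v, 4 := bs)"
  let ?s3 = "?e(0 := v, 4 := bs, 6 := bits n, 8 := replicate n True)"
  let ?s4 = "?e(0 := v, 4 := bs, 6 := bits n, 8 := replicate n True, 9 := rev hd)"
  let ?s5 = "?e(4 := bs, 6 := bits n, 7 := replicate n True, 9 := rev cs @ rev hd)"
  let ?s6 = "?e(4 := bs, 6 := bits n, 7 := replicate n True, 9 := rev (reduction w))"
  have 1: "runs (read 0 4) (?e(0 := w)) (12 * l + 10) ?s1"
    by (rule runs_mono[OF runs_read]) (auto simp: fun_eq_iff v_def bs_def l_def)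
  have 2: "runs copy ?s1 (9 * l + 2) ?s2"
    by (rule runs_mono[OF runs_copy]) (use v in \<open>auto simp: fun_eq_iff\<close>)
  have 3: "runs count_weights ?s2 ((l + 1) * (24 * l + 32) + 4 * l + 2) ?s3"
    by (rule runs_mono[OF runs_count_weights[of _ l]]) (use v in \<open>auto simp: fun_eq_iff n_def\<close>)
  have 4: "runs (Seq (pushes 9 (enc_rat (1 / 2) @ [False])) (Seq (emit 6) (pushes 9 (enc_int 1))))
      ?s3 (11 * l + 20) ?s4"
    by (rule runs_mono[OF runs_Seq[OF runs_pushes runs_Seq[OF runs_emit runs_pushes]]])
      (use n length_bits[of n] in \<open>auto simp: fun_eq_iff hd_def length_enc_const\<close>)
  have 5: "runs put_weight_columns ?s4 ((l + 1) * ((11 * l + 48) * l + 16 * l + 29) + 4 * l + 2) ?s5"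
    by (rule runs_mono[OF runs_put_weight_columns[of _ n l]])
      (use v in \<open>auto simp: fun_eq_iff n_def cs_def\<close>)
  have for_each: "runs (for_each 7 put_target_entries) (?s5(9 := True # ?s5 9))
      ((22 * l + 40 + 8) * length ((?s5(9 := True # ?s5 9)) 7) + 2)
      (?s5(9 := rev ts @ True # ?s5 9))"
    by (rule runs_mono[OF runs_for_each[where m = "22 * l + 40" and ys = "rev (target_entries bs (bits n))"]])
      (use bs n length_bits[of n] in \<open>auto simp: fun_eq_iff ts_def rev_concat_replicate
        intro!: runs_mono[OF runs_put_target_entries]\<close>)
  have "reduction w = hd @ cs @ True # ts @ [False, False]"
    by (simp add: reduction_def Let_def hd_def cs_def ts_def target_column_def n_def v_def bs_def)
  moreover have "(22 * l + 48) * n \<le> (22 * l + 48) * l"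
    using n by (intro mult_le_mono) simp_all
  ultimately have 6: "runs (Seq (Push 9 True) (Seq (for_each 7 put_target_entries) (pushes 9 [False, False])))
      ?s5 ((22 * l + 48) * l + 6) ?s6"
    by (intro runs_mono[OF runs_Seq[OF runs_Push runs_Seq[OF for_each runs_pushes]]])
      (auto simp: fun_eq_iff algebra_simps)
  let ?p = "Seq (read 0 4) (Seq copy (Seq count_weights
       (Seq (Seq (pushes 9 (enc_rat (1 / 2) @ [False])) (Seq (emit 6) (pushes 9 (enc_int 1))))
       (Seq put_weight_columns
       (Seq (Push 9 True) (Seq (for_each 7 put_target_entries) (pushes 9 [False, False])))))))"
  have p: "runs ?p (?e(0 := w)) (103 * (l + 1) ^ 3) ?s6"
    by (rule runs_mono[OF runs_Seq[OF 1 runs_Seq[OF 2 runs_Seq[OF 3 runs_Seq[OF 4 runs_Seq[OF 5 6]]]]]])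
      (simp_all add: algebra_simps power3_eq_cube)
  \<comment> \<open>The cost of the final move depends on the output length, which is bounded by the
    time spent so far.\<close>
  from runs_length[OF p, of 9] have "length (reduction w) \<le> 103 * (l + 1) ^ 3" by simp
  moreover have "1 \<le> (l + 1) ^ 3" by simp
  ultimately have "103 * (l + 1) ^ 3 + (4 * length (reduction w) + 1) \<le> 1000 * (l + 1) ^ 3"
    by linarith
  then have "runs reduction_prog (?e(0 := w)) (1000 * (l + 1) ^ 3) (?s6(9 := [], 0 := reduction w))"
    unfolding reduction_prog_def by (intro runs_mono[OF runs_Seq[OF p runs_move]]) auto
  then show ?thesis unfolding l_def
    by (rule exI[where x = "?s6(9 := [], 0 := reduction w)", OF conjI]) simp
qed

lemma poly_time_reduction: "poly_time reduction"
proof -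
  let ?q = "[:1000:] * [:1, 1:] ^ 3 :: nat poly"
  have "\<exists>t s. exec reduction_prog ((\<lambda>_. [])(0 := w)) t s \<and> s 0 = reduction w \<and> t \<le> poly ?q (length w)"
    for w
    using runs_reduction_prog[of w] unfolding runs_def by (auto simp: poly_power)
  then show ?thesis unfolding poly_time_def by blast
qed

section \<open>The lattice\<close>

text \<open>Bernoulli's inequality for real exponents. For positive \<open>t\<close>,
  \<open>t powr p = t * exp ((p - 1) * ln t)\<close> is at least
  \<open>t + (p - 1) * (t * ln t)\<close>, and \<open>t * ln t\<close> is at least
  \<open>t - 1\<close>.\<close>

lemma powr_ge_tangent:
  fixes t p :: real
  assumes "0 \<le> t" "1 \<le> p"
  shows "1 + p * (t - 1) \<le> t powr p"
proof (cases "t = 0")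
  case False
  with assms have t: "0 < t" by simp
  \<comment> \<open>This is \<open>ln (1 + x) \<le> x\<close> at
    \<open>x = 1 / t - 1\<close>.\<close>
  have "1 - inverse t \<le> ln t"
    using ln_add_one_self_le_self2[of "inverse t - 1"] t by (simp add: ln_inverse)
  then have "t - 1 \<le> t * ln t"
    using mult_left_mono[of "1 - inverse t" "ln t" t] t by (simp add: algebra_simps)
  then have "(p - 1) * (t - 1) \<le> (p - 1) * (t * ln t)"
    using assms by (intro mult_left_mono) auto
  moreover have "t * (1 + (p - 1) * ln t) \<le> t * exp ((p - 1) * ln t)"
    using exp_ge_add_one_self[of "(p - 1) * ln t"] t by (intro mult_left_mono) auto
  moreover have "t * exp ((p - 1) * ln t) = t powr p"
    using t by (simp add: powr_def left_diff_distrib exp_diff)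
  ultimately show ?thesis by (simp add: algebra_simps)
qed (use assms in simp)

lemma lp_norm_le_iff:
  assumes "1 \<le> p" "0 \<le> r"
  shows "lp_norm p v \<le> r \<longleftrightarrow> (\<Sum>i<dim_vec v. \<bar>v $ i\<bar> powr p) \<le> r powr p"
proof
  let ?S = "\<Sum>i<dim_vec v. \<bar>v $ i\<bar> powr p"
  have S: "0 \<le> ?S" by (intro sum_nonneg) simp
  {
    assume "lp_norm p v \<le> r"
    then have "(?S powr (1 / p)) powr p \<le> r powr p"
      using assms unfolding lp_norm_def by (intro powr_mono2) auto
    then show "?S \<le> r powr p" using S assms by (simp add: powr_powr)
  next
    assume "?S \<le> r powr p"
    then have "?S powr (1 / p) \<le> (r powr p) powr (1 / p)"
      using S assms by (intro powr_mono2) auto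
    then show "lp_norm p v \<le> r" using assms by (simp add: powr_powr lp_norm_def)
  }
qed

lemma abs_index_le_lp_norm:
  assumes "1 \<le> p" "i < dim_vec v"
  shows "\<bar>v $ i\<bar> \<le> lp_norm p v"
proof -
  have "0 \<le> lp_norm p v" by (simp add: lp_norm_def)
  then have "(\<Sum>i<dim_vec v. \<bar>v $ i\<bar> powr p) \<le> lp_norm p v powr p"
    using lp_norm_le_iff[OF assms(1)] by blast
  moreover have "\<bar>v $ i\<bar> powr p \<le> (\<Sum>i<dim_vec v. \<bar>v $ i\<bar> powr p)"
    using assms(2) by (intro member_le_sum) auto
  ultimately have "\<bar>v $ i\<bar> powr p \<le> lp_norm p v powr p" by simp
  then show ?thesis
    using assms(1) \<open>0 \<le> lp_norm p v\<close> powr_less_mono2[of p "lp_norm p v" "\<bar>v $ i\<bar>"]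
    by linarith
qed

section \<open>Existence of a shortest nonzero vector\<close>

text \<open>\<open>LEAST\<close> over the reals says something only if a minimum exists. Here all
  entries are multiples of \<open>1 / N\<close>, and only finitely many such vectors are no longer
  than the given \<open>v0\<close>.\<close>

lemma lambda1_attained:
  fixes N :: nat
  assumes p: "1 \<le> p" and N: "0 < N" and L: "L \<subseteq> carrier_vec d"
    and int: "\<And>v i. v \<in> L \<Longrightarrow> i < d \<Longrightarrow> real N * v $ i \<in> \<int>"
    and v0: "v0 \<in> L" "v0 \<noteq> 0\<^sub>v d"
  obtains v where "v \<in> L" "v \<noteq> 0\<^sub>v d" "lambda1 p L = lp_norm p v"
    and "\<And>w. w \<in> L \<Longrightarrow> w \<noteq> 0\<^sub>v d \<Longrightarrow> lambda1 p L \<le> lp_norm p w"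
proof -
  let ?P = "\<lambda>r. \<exists>v\<in>L. v \<noteq> 0\<^sub>v (dim_vec v) \<and> r = lp_norm p v"
  let ?R = "lp_norm p v0"
  let ?M = "{v \<in> L. v \<noteq> 0\<^sub>v d \<and> lp_norm p v \<le> ?R}"
  define K where "K = \<lceil>real N * ?R\<rceil>"
  \<comment> \<open>A vector of \<open>?M\<close> is determined by the integers
    \<open>N * v $ i\<close>, and these lie between \<open>- K\<close> and \<open>K\<close> because
    no entry exceeds the norm.\<close>
  have "?M \<subseteq> (\<lambda>f. vec d (\<lambda>i. real_of_int (f i) / real N)) ` (PiE {..<d} (\<lambda>_. {- K..K}))"
  proof
    fix v assume v: "v \<in> ?M"
    then have vL: "v \<in> L" and v_le: "lp_norm p v \<le> ?R" and d: "dim_vec v = d" using L by auto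
    define f where "f = (\<lambda>i\<in>{..<d}. \<lfloor>real N * v $ i\<rfloor>)"
    have f: "real_of_int \<lfloor>real N * v $ i\<rfloor> = real N * v $ i" if "i < d" for i
      using int[OF vL that] by simp
    have "v = vec d (\<lambda>i. real_of_int (f i) / real N)"
    proof (rule eq_vecI)
      fix i assume "i < dim_vec (vec d (\<lambda>i. real_of_int (f i) / real N))"
      then have "i < d" by simp
      have "vec d (\<lambda>i. real_of_int (f i) / real N) $ i = real_of_int \<lfloor>real N * v $ i\<rfloor> / real N"
        using \<open>i < d\<close> by (simp add: f_def)
      also have "\<dots> = v $ i" using N by (simp only: f[OF \<open>i < d\<close>]) simp
      finally show "v $ i = vec d (\<lambda>i. real_of_int (f i) / real N) $ i" ..
    qed (use d in simp)
    moreover have "f \<in> PiE {..<d} (\<lambda>_. {- K..K})"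
    proof (rule PiE_I)
      fix i assume i: "i \<in> {..<d}"
      have "\<bar>v $ i\<bar> \<le> ?R" using order_trans[OF abs_index_le_lp_norm[OF p] v_le] i d by simp
      then have "real N * \<bar>v $ i\<bar> \<le> real N * ?R" by (intro mult_left_mono) auto
      also have "\<dots> \<le> real_of_int K" by (simp add: K_def)
      finally have "\<bar>real N * v $ i\<bar> \<le> real_of_int K" by (simp add: abs_mult)
      moreover have "real_of_int (f i) = real N * v $ i"
        using i by (simp only: f_def restrict_apply lessThan_iff if_True f)
      ultimately have "\<bar>real_of_int (f i)\<bar> \<le> real_of_int K" by simp
      then show "f i \<in> {- K..K}" by auto
    qed (simp add: f_def)
    ultimately show "v \<in> (\<lambda>f. vec d (\<lambda>i. real_of_int (f i) / real N)) ` (PiE {..<d} (\<lambda>_. {- K..K}))"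
      by blast
  qed
  then have "finite ?M"
    by (rule finite_subset) (intro finite_imageI finite_PiE, simp_all)
  then have fin: "finite (lp_norm p ` ?M)"
    by (rule finite_imageI)
  have ne: "?R \<in> lp_norm p ` ?M" using v0 by auto
  define r where "r = Min (lp_norm p ` ?M)"
  have "r \<in> lp_norm p ` ?M" unfolding r_def using fin ne by (intro Min_in) auto
  then obtain v where v: "v \<in> L" "v \<noteq> 0\<^sub>v d" "r = lp_norm p v" by auto
  have min: "r \<le> lp_norm p w" if "w \<in> L" "w \<noteq> 0\<^sub>v d" for w
  proof (cases "lp_norm p w \<le> ?R")
    case True
    then show ?thesis unfolding r_def using fin that by (intro Min_le) auto
  next
    case False
    have "r \<le> ?R" unfolding r_def using fin ne by (intro Min_le) auto
    with False show ?thesis by simp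
  qed
  have lambda1: "lambda1 p L = r"
    unfolding lambda1_def
  proof (rule Least_equality)
    have "dim_vec v = d" using v L by auto
    with v show "?P r" by auto
  next
    fix r' assume "?P r'"
    then obtain w where "w \<in> L" "w \<noteq> 0\<^sub>v (dim_vec w)" "r' = lp_norm p w" by blast
    moreover from this have "dim_vec w = d" using L by auto
    ultimately show "r \<le> r'" using min by simp
  qed
  show ?thesis
  proof (rule that)
    show "v \<in> L" "v \<noteq> 0\<^sub>v d" "lambda1 p L = lp_norm p v"
      using v lambda1 by simp_all
    show "lambda1 p L \<le> lp_norm p w" if "w \<in> L" "w \<noteq> 0\<^sub>v d" for w
      using min that lambda1 by simp
  qed
qed

section \<open>The basis matrix and its linear independence\<close>

text \<open>Interleaving the three kinds of rows makes each column a run of \<open>n\<close> nearly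
  identical blocks, which a loop can write. The factor \<open>6 / 5\<close> turns the target
  cardinality \<open>5 / 6 * n\<close> into \<open>n\<close>, so the program need not
  divide.\<close>

definition svp_basis :: "nat list \<Rightarrow> nat \<Rightarrow> rat mat" where
  "svp_basis a s = (let n = length a in mat (3 * n) (n + 1) (\<lambda>(r, i).
     if r mod 3 = 0 then (if i = n then - 1 / 2 else if i = r div 3 then 1 else 0)
     else if r mod 3 = 1 then (if i = n then - of_nat s else of_nat (a ! i))
     else (if i = n then - of_nat n else 6 / 5)))"

definition real_basis :: "nat list \<Rightarrow> nat \<Rightarrow> real mat" where
  "real_basis a s = map_mat real_of_rat (svp_basis a s)"

lemma dim_svp_basis [simp]:
  "dim_row (svp_basis a s) = 3 * length a" "dim_col (svp_basis a s) = length a + 1"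
  by (simp_all add: svp_basis_def Let_def)

lemma real_basis_carrier: "real_basis a s \<in> carrier_mat (3 * length a) (length a + 1)"
  by (rule carrier_matI) (simp_all add: real_basis_def)

lemma dim_real_basis [simp]:
  "dim_row (real_basis a s) = 3 * length a" "dim_col (real_basis a s) = length a + 1"
  by (simp_all add: real_basis_def)

lemma index_svp_basis:
  assumes "j < length a" "i < length a"
  shows "svp_basis a s $$ (3 * j, i) = (if j = i then 1 else 0)"
    and "svp_basis a s $$ (3 * j, length a) = - 1 / 2"
    and "svp_basis a s $$ (3 * j + 1, i) = of_nat (a ! i)"
    and "svp_basis a s $$ (3 * j + 1, length a) = - of_nat s"
    and "svp_basis a s $$ (3 * j + 2, i) = 6 / 5"
    and "svp_basis a s $$ (3 * j + 2, length a) = - of_nat (length a)"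
proof -
  have "(3 * j + 1) mod 3 = 1" "(3 * j + 2) mod 3 = 2" by presburger+
  moreover have "3 * j + 1 < 3 * length a" "3 * j + 2 < 3 * length a" using assms by simp_all
  ultimately show "svp_basis a s $$ (3 * j, i) = (if j = i then 1 else 0)"
    and "svp_basis a s $$ (3 * j, length a) = - 1 / 2"
    and "svp_basis a s $$ (3 * j + 1, i) = of_nat (a ! i)"
    and "svp_basis a s $$ (3 * j + 1, length a) = - of_nat s"
    and "svp_basis a s $$ (3 * j + 2, i) = 6 / 5"
    and "svp_basis a s $$ (3 * j + 2, length a) = - of_nat (length a)"
    using assms by (auto simp: svp_basis_def Let_def)
qed

lemma index_real_basis:
  assumes "j < length a" "i < length a"
  shows "real_basis a s $$ (3 * j, i) = (if j = i then 1 else 0)"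
    and "real_basis a s $$ (3 * j, length a) = - 1 / 2"
    and "real_basis a s $$ (3 * j + 1, i) = real (a ! i)"
    and "real_basis a s $$ (3 * j + 1, length a) = - real s"
    and "real_basis a s $$ (3 * j + 2, i) = 6 / 5"
    and "real_basis a s $$ (3 * j + 2, length a) = - real (length a)"
proof -
  have *: "real_basis a s $$ (r, k) = real_of_rat (svp_basis a s $$ (r, k))"
    if "r < 3 * length a" "k < length a + 1" for r k
    using that by (simp add: real_basis_def)
  have "3 * j < 3 * length a" "3 * j + 1 < 3 * length a" "3 * j + 2 < 3 * length a"
    "i < length a + 1" "length a < length a + 1"
    using assms by simp_all
  note * = *[OF this(1) this(4)] *[OF this(1) this(5)] *[OF this(2) this(4)] *[OF this(2) this(5)]
    *[OF this(3) this(4)] *[OF this(3) this(5)]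
  show "real_basis a s $$ (3 * j, i) = (if j = i then 1 else 0)"
    and "real_basis a s $$ (3 * j, length a) = - 1 / 2"
    and "real_basis a s $$ (3 * j + 1, i) = real (a ! i)"
    and "real_basis a s $$ (3 * j + 1, length a) = - real s"
    and "real_basis a s $$ (3 * j + 2, i) = 6 / 5"
    and "real_basis a s $$ (3 * j + 2, length a) = - real (length a)"
    unfolding * index_svp_basis[OF assms] by (simp_all add: of_rat_divide of_rat_minus)
qed

lemma real_basis_mult:
  assumes z: "z \<in> carrier_vec (length a + 1)" and j: "j < length a"
  shows "(real_basis a s *\<^sub>v z) $ (3 * j) = z $ j - z $ length a / 2"
    and "(real_basis a s *\<^sub>v z) $ (3 * j + 1) = (\<Sum>i<length a. real (a ! i) * z $ i) - real s * z $ length a"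
    and "(real_basis a s *\<^sub>v z) $ (3 * j + 2) = 6 / 5 * (\<Sum>i<length a. z $ i) - real (length a) * z $ length a"
proof -
  have r: "3 * j < 3 * length a" "3 * j + 1 < 3 * length a" "3 * j + 2 < 3 * length a"
    using j by simp_all
  have row: "(real_basis a s *\<^sub>v z) $ r = (\<Sum>i<length a. real_basis a s $$ (r, i) * z $ i)
      + real_basis a s $$ (r, length a) * z $ length a" if "r < 3 * length a" for r
    using that z by (simp add: scalar_prod_def atLeast0LessThan)
  have "(\<Sum>i<length a. real_basis a s $$ (3 * j, i) * z $ i) = (\<Sum>i<length a. if i = j then z $ i else 0)"
    using j by (intro sum.cong) (auto simp: index_real_basis)
  then show "(real_basis a s *\<^sub>v z) $ (3 * j) = z $ j - z $ length a / 2"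
    using j by (simp add: row[OF r(1)] index_real_basis(2)[OF j j])
  have "(\<Sum>i<length a. real_basis a s $$ (3 * j + 1, i) * z $ i) = (\<Sum>i<length a. real (a ! i) * z $ i)"
    using index_real_basis(3)[OF j] by (intro sum.cong) auto
  then show "(real_basis a s *\<^sub>v z) $ (3 * j + 1) = (\<Sum>i<length a. real (a ! i) * z $ i) - real s * z $ length a"
    unfolding row[OF r(2)] index_real_basis(4)[OF j j] by simp
  have "(\<Sum>i<length a. real_basis a s $$ (3 * j + 2, i) * z $ i) = (\<Sum>i<length a. 6 / 5 * z $ i)"
    using index_real_basis(5)[OF j] by (intro sum.cong) auto
  then show "(real_basis a s *\<^sub>v z) $ (3 * j + 2) = 6 / 5 * (\<Sum>i<length a. z $ i) - real (length a) * z $ length a"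
    unfolding row[OF r(3)] index_real_basis(6)[OF j j] by (simp add: sum_distrib_left)
qed

text \<open>With \<open>y\<close> the last coefficient, the first row of each triple forces every
  other coefficient to be \<open>y / 2\<close>. The third row then reads
  \<open>3 / 5 * n * y - n * y = 0\<close>, hence \<open>y = 0\<close>. The coefficients are real,
  as linear independence over the reals demands.\<close>

lemma real_basis_mult_eq_0:
  assumes z: "z \<in> carrier_vec (length a + 1)" and 0: "real_basis a s *\<^sub>v z = 0\<^sub>v (3 * length a)" and "a \<noteq> []"
  shows "z = 0\<^sub>v (length a + 1)"
proof -
  let ?n = "length a"
  have z_half: "z $ j = z $ ?n / 2" if "j < ?n" for j
    using real_basis_mult(1)[OF z that, of s] that unfolding 0 by simp
  then have "(\<Sum>i<?n. z $ i) = (\<Sum>i<?n. z $ ?n / 2)" by (intro sum.cong) auto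
  then have "(\<Sum>i<?n. z $ i) = ?n * (z $ ?n / 2)" by simp
  moreover have "0 < ?n" using \<open>a \<noteq> []\<close> by simp
  moreover from this have "2 < 3 * ?n" by linarith
  then have "6 / 5 * (\<Sum>i<?n. z $ i) - real ?n * z $ ?n = 0"
    using real_basis_mult(3)[OF z \<open>0 < ?n\<close>, of s] unfolding 0 by simp
  ultimately have "real ?n * z $ ?n = 0" by linarith
  with \<open>0 < ?n\<close> have "z $ ?n = 0" by simp
  with z_half z show ?thesis by (intro eq_vecI) (auto simp: less_Suc_eq)
qed

lemma is_basis_real_basis:
  assumes "a \<noteq> []"
  shows "is_basis (real_basis a s)"
proof -
  let ?n = "length a" and ?B = "real_basis a s"
  note B = real_basis_carrier[of a s]
  \<comment> \<open>Row \<open>3 * i\<close> separates the columns: it has 1 in column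
    \<open>i\<close>, and 0 or \<open>- 1 / 2\<close> in a later one.\<close>
  have "cols ?B ! i \<noteq> cols ?B ! j" if "i < j" "j < ?n + 1" for i j
  proof
    assume "cols ?B ! i = cols ?B ! j"
    then have "col ?B i $ (3 * i) = col ?B j $ (3 * i)" using that by simp
    then have "?B $$ (3 * i, i) = ?B $$ (3 * i, j)" using that by simp
    then show False
      using that index_real_basis(1)[of i a i s] index_real_basis(1)[of i a j s]
        index_real_basis(2)[of i a i s] by (cases "j = ?n") auto
  qed
  then have distinct: "distinct (cols ?B)"
    unfolding distinct_conv_nth cols_length dim_real_basis by (metis linorder_neqE_nat)
  have "module.lin_indpt class_ring (module_vec TYPE(real) (3 * ?n)) (set (cols ?B))"
  proof
    assume "module.lin_dep class_ring (module_vec TYPE(real) (3 * ?n)) (set (cols ?B))"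
    from vec_space.lin_depE[OF B this distinct] obtain z where
      "z \<in> carrier_vec (?n + 1)" "z \<noteq> 0\<^sub>v (?n + 1)" "?B *\<^sub>v z = 0\<^sub>v (3 * ?n)" .
    then show False using real_basis_mult_eq_0[OF _ _ assms] by blast
  qed
  with distinct show ?thesis by (simp add: is_basis_def)
qed

lemma sum_triples: "(\<Sum>r<3 * n. f r) = (\<Sum>j<n. f (3 * j) + f (3 * j + 1) + f (3 * j + 2))"
  for f :: "nat \<Rightarrow> 'a :: comm_monoid_add"
proof (induction n)
  case (Suc n)
  have "3 * Suc n = Suc (Suc (Suc (3 * n)))" by simp
  then show ?case by (simp only: sum.lessThan_Suc Suc.IH) (simp add: add.assoc)
qed simp

text \<open>The second and third entries of a triple do not depend on \<open>j\<close>, whence the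
  factor \<open>length a\<close>.\<close>

lemma sum_powr_real_basis:
  fixes a :: "nat list" and s :: nat and z :: "int vec" and p :: real
  assumes z: "z \<in> carrier_vec (length a + 1)"
  defines "v \<equiv> real_basis a s *\<^sub>v map_vec real_of_int z"
  shows "(\<Sum>r<dim_vec v. \<bar>v $ r\<bar> powr p) =
    (\<Sum>j<length a. \<bar>real_of_int (z $ j) - real_of_int (z $ length a) / 2\<bar> powr p)
    + real (length a) * \<bar>real_of_int ((\<Sum>i<length a. int (a ! i) * z $ i) - int s * z $ length a)\<bar> powr p
    + real (length a) * \<bar>6 / 5 * real_of_int (\<Sum>i<length a. z $ i) - real (length a) * real_of_int (z $ length a)\<bar> powr p"
proof -
  have *: "map_vec real_of_int z \<in> carrier_vec (length a + 1)" using z by simp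
  have "(\<Sum>r<dim_vec v. \<bar>v $ r\<bar> powr p) = (\<Sum>r<3 * length a. \<bar>v $ r\<bar> powr p)"
    by (simp add: v_def)
  also have "\<dots> = (\<Sum>j<length a. \<bar>v $ (3 * j)\<bar> powr p + \<bar>v $ (3 * j + 1)\<bar> powr p + \<bar>v $ (3 * j + 2)\<bar> powr p)"
    by (rule sum_triples)
  also have "\<dots> = (\<Sum>j<length a. \<bar>real_of_int (z $ j) - real_of_int (z $ length a) / 2\<bar> powr p
    + \<bar>real_of_int ((\<Sum>i<length a. int (a ! i) * z $ i) - int s * z $ length a)\<bar> powr p
    + \<bar>6 / 5 * real_of_int (\<Sum>i<length a. z $ i) - real (length a) * real_of_int (z $ length a)\<bar> powr p)"
  proof (rule sum.cong)
    fix j assume j: "j \<in> {..<length a}"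
    then have "j < length a" by simp
    show "\<bar>v $ (3 * j)\<bar> powr p + \<bar>v $ (3 * j + 1)\<bar> powr p + \<bar>v $ (3 * j + 2)\<bar> powr p =
      \<bar>real_of_int (z $ j) - real_of_int (z $ length a) / 2\<bar> powr p
      + \<bar>real_of_int ((\<Sum>i<length a. int (a ! i) * z $ i) - int s * z $ length a)\<bar> powr p
      + \<bar>6 / 5 * real_of_int (\<Sum>i<length a. z $ i) - real (length a) * real_of_int (z $ length a)\<bar> powr p"
      unfolding v_def real_basis_mult[OF * \<open>j < length a\<close>] using j z by simp
  qed simp
  finally show ?thesis by (simp add: sum.distrib)
qed


section \<open>Short vectors and subset sums\<close>

lemma lp_norm_le_half_iff:
  assumes "1 \<le> p"
  shows "lp_norm p v \<le> 1 / 2 * real n powr (1 / p) \<longleftrightarrow>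
    (\<Sum>i<dim_vec v. \<bar>v $ i\<bar> powr p) \<le> (1 / 2) powr p * real n"
proof -
  have "(1 / 2 * real n powr (1 / p)) powr p = (1 / 2) powr p * (real n powr (1 / p)) powr p"
    by (rule powr_mult)
  also have "(real n powr (1 / p)) powr p = real n" using assms by (simp add: powr_powr)
  finally show ?thesis
    using lp_norm_le_iff[OF assms, of "1 / 2 * real n powr (1 / p)" v] by simp
qed

text \<open>The tangent bound at 1, applied to \<open>2 * \<bar>w\<bar>\<close> and rescaled, is the
  tangent at \<open>1 / 2\<close>.\<close>

lemma powr_ge_half_tangent:
  assumes "1 \<le> p"
  shows "(1 / 2) powr p * (1 + p * (2 * \<bar>w\<bar> - 1)) \<le> \<bar>w :: real\<bar> powr p"
proof -
  have "(1 / 2) powr p * (1 + p * (2 * \<bar>w\<bar> - 1)) \<le> (1 / 2) powr p * (2 * \<bar>w\<bar>) powr p"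
    using assms by (intro mult_left_mono powr_ge_tangent) auto
  also have "\<dots> = \<bar>w\<bar> powr p" by (simp flip: powr_mult)
  finally show ?thesis .
qed

lemma short_vector_imp_solvable:
  fixes z :: "int vec"
  assumes p: "1 \<le> p" and m: "0 < m" "length a = 6 * m"
    and indep: "\<not> p_dependent p (1 / 2) a"
    and z: "z \<in> carrier_vec (length a + 1)" "z \<noteq> 0\<^sub>v (length a + 1)"
    and short: "lp_norm p (real_basis a s *\<^sub>v map_vec real_of_int z) \<le> 1 / 2 * real (length a) powr (1 / p)"
  shows "ss_solvable (5 / 6) a s"
proof -
  define n where "n = length a"
  define y where "y = z $ n"
  define h :: real where "h = (1 / 2) powr p"
  define w where "w j = real_of_int (z $ j) - real_of_int y / 2" for j
  define A where "A = (\<Sum>i<n. int (a ! i) * z $ i) - int s * y"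
  \<comment> \<open>\<open>5 * m\<close> is the required number of ones, \<open>5 / 6 * n\<close>.
    The scaled third constraint is \<open>6 / 5 * C\<close> with \<open>C\<close> an
    integer.\<close>
  define C where "C = (\<Sum>i<n. z $ i) - 5 * int m * y"
  have n: "real n = 6 * real m" "0 < n" using m by (simp_all add: n_def)
  have "h \<le> (1 / 2) powr 1" unfolding h_def using p by (intro powr_mono') auto
  then have h: "0 < h" "h < 1" by (simp_all add: h_def)
  have sum_le: "(\<Sum>j<n. \<bar>w j\<bar> powr p) + real n * \<bar>real_of_int A\<bar> powr p
      + real n * \<bar>6 / 5 * real_of_int C\<bar> powr p \<le> h * real n"
  proof -
    have "6 / 5 * real_of_int (\<Sum>i<n. z $ i) - real n * real_of_int y = 6 / 5 * real_of_int C"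
      by (simp add: C_def n(1) algebra_simps)
    then show ?thesis
      using short unfolding lp_norm_le_half_iff[OF p] sum_powr_real_basis[OF z(1)]
      by (simp only: w_def A_def y_def h_def n_def)
  qed
  \<comment> \<open>Used with \<open>r = 1\<close> for \<open>A\<close> and \<open>r = 6 / 5\<close>
    for \<open>C\<close>: a nonzero integer would contribute at least \<open>n\<close>, more than
    the whole budget \<open>h * n\<close>.\<close>
  have small: "k = 0" if "real n * \<bar>r * real_of_int k\<bar> powr p \<le> h * real n" "1 \<le> r" for k :: int and r :: real
  proof (rule ccontr)
    assume "k \<noteq> 0"
    then have "1 \<le> \<bar>real_of_int k\<bar>" by linarith
    then have "1 * 1 \<le> \<bar>r * real_of_int k\<bar>" unfolding abs_mult using that(2) by (intro mult_mono) auto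
    then have "1 \<le> \<bar>r * real_of_int k\<bar> powr p" using p by (simp add: ge_one_powr_ge_zero)
    then have "real n * 1 \<le> real n * \<bar>r * real_of_int k\<bar> powr p" by (intro mult_left_mono) auto
    also have "\<dots> \<le> h * real n" by (rule that(1))
    also have "\<dots> < 1 * real n" using h n by (intro mult_strict_right_mono) auto
    finally show False by simp
  qed
  have nonneg: "0 \<le> (\<Sum>j<n. \<bar>w j\<bar> powr p)" "0 \<le> real n * \<bar>real_of_int A\<bar> powr p"
    "0 \<le> real n * \<bar>6 / 5 * real_of_int C\<bar> powr p"
    by (simp_all add: sum_nonneg)
  have "real n * \<bar>1 * real_of_int A\<bar> powr p \<le> h * real n"
    unfolding mult_1_left using sum_le nonneg by linarith
  then have A: "A = 0" by (rule small) simp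
  have "real n * \<bar>6 / 5 * real_of_int C\<bar> powr p \<le> h * real n" using sum_le nonneg by linarith
  then have C: "C = 0" by (rule small) simp
  have w_le: "(\<Sum>j<n. \<bar>w j\<bar> powr p) \<le> h * real n" using sum_le nonneg by linarith
  have "y \<noteq> 0"
  proof
    assume y: "y = 0"
    define x where "x = vec n (\<lambda>i. z $ i)"
    have "x \<in> carrier_vec (length a)" by (simp add: x_def n_def)
    moreover have "x \<noteq> 0\<^sub>v (length a)"
    proof
      assume "x = 0\<^sub>v (length a)"
      then have "z $ i = 0" if "i < n" for i
        using that by (metis index_vec index_zero_vec(1) n_def x_def)
      then have "z = 0\<^sub>v (length a + 1)"
        using z(1) y by (intro eq_vecI) (auto simp: less_Suc_eq n_def y_def)
      with z(2) show False ..
    qed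
    moreover have "(\<Sum>i<length a. int (a ! i) * x $ i) = 0" "(\<Sum>i<length a. x $ i) = 0"
      using A C y by (simp_all add: A_def C_def x_def n_def)
    moreover have "lp_norm p (map_vec real_of_int x) \<le> 1 / 2 * real (length a) powr (1 / p)"
    proof -
      have "(\<Sum>j<n. \<bar>real_of_int (z $ j)\<bar> powr p) \<le> h * real n" using w_le by (simp add: w_def y)
      then show ?thesis
        unfolding lp_norm_le_half_iff[OF p] by (simp add: x_def n_def h_def)
    qed
    ultimately show False using indep unfolding p_dependent_def by blast
  qed
  have w_abs: "(\<Sum>j<n. \<bar>w j\<bar>) \<le> real n / 2"
  proof -
    \<comment> \<open>Summing the tangent bounds gives \<open>h * n\<close> plus a multiple of
      \<open>2 * (\<Sum>j<n. \<bar>w j\<bar>) - n\<close>. As the budget is just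
      \<open>h * n\<close>, that multiple cannot be positive.\<close>
    have "h * (real n + p * (2 * (\<Sum>j<n. \<bar>w j\<bar>) - real n)) = (\<Sum>j<n. h * (1 + p * (2 * \<bar>w j\<bar> - 1)))"
      by (simp add: sum.distrib sum_subtractf flip: sum_distrib_left)
    also have "\<dots> \<le> (\<Sum>j<n. \<bar>w j\<bar> powr p)"
      unfolding h_def by (intro sum_mono powr_ge_half_tangent p)
    also have "\<dots> \<le> h * real n" by (rule w_le)
    finally have "p * (2 * (\<Sum>j<n. \<bar>w j\<bar>) - real n) \<le> 0" using h by simp
    then show ?thesis using p by (simp add: mult_le_0_iff)
  qed
  have "\<bar>y\<bar> = 1"
  proof -
    \<comment> \<open>By \<open>C = 0\<close> the sum is \<open>5 * m * y - 3 * m * y\<close>. Its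
      absolute value is at most \<open>n / 2 = 3 * m\<close>, so
      \<open>\<bar>y\<bar> \<le> 3 / 2\<close>.\<close>
    have "(\<Sum>j<n. w j) = real_of_int (\<Sum>i<n. z $ i) - real n * (real_of_int y / 2)"
      by (simp add: w_def sum_subtractf)
    also have "\<dots> = 2 * real m * real_of_int y"
      using C n by (simp add: C_def)
    finally have "2 * real m * \<bar>real_of_int y\<bar> \<le> (\<Sum>j<n. \<bar>w j\<bar>)"
      using sum_abs[of w "{..<n}"] by (simp add: abs_mult)
    also have "\<dots> \<le> 3 * real m" using w_abs n by simp
    finally have "2 * real m * \<bar>real_of_int y\<bar> \<le> 3 * real m" .
    then have "\<bar>real_of_int y\<bar> \<le> 3 / 2" using m by simp
    with \<open>y \<noteq> 0\<close> show ?thesis by linarith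
  qed
  then have y: "y = 1 \<or> y = - 1" by linarith
  have bit: "z $ j * y \<in> {0, 1}" if j: "j < n" for j
  proof -
    \<comment> \<open>\<open>y\<close> is odd, so \<open>2 * z $ i - y\<close> is odd and at least 1
      in absolute value. With the mean of the \<open>\<bar>w i\<bar>\<close> at most
      \<open>1 / 2\<close>, all of them must equal \<open>1 / 2\<close>.\<close>
    have ge: "0 \<le> \<bar>w i\<bar> - 1 / 2" for i
    proof -
      have "1 \<le> \<bar>2 * z $ i - y\<bar>" using y by presburger
      then have "1 \<le> real_of_int \<bar>2 * z $ i - y\<bar>" by linarith
      then have "1 \<le> \<bar>2 * real_of_int (z $ i) - real_of_int y\<bar>" by simp
      then show ?thesis unfolding w_def by linarith
    qed
    have "(\<Sum>i<n. \<bar>w i\<bar> - 1 / 2) \<le> 0" using w_abs by (simp add: sum_subtractf)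
    moreover have "\<bar>w j\<bar> - 1 / 2 \<le> (\<Sum>i<n. \<bar>w i\<bar> - 1 / 2)"
      using j ge by (intro member_le_sum) auto
    ultimately have "\<bar>w j\<bar> = 1 / 2" using ge[of j] by linarith
    then have "\<bar>2 * real_of_int (z $ j) - real_of_int y\<bar> = 1" unfolding w_def by linarith
    then have "\<bar>real_of_int (2 * z $ j - y)\<bar> = 1" by simp
    then have "\<bar>2 * z $ j - y\<bar> = 1" by linarith
    with y show ?thesis by auto
  qed
  \<comment> \<open>Multiplying by \<open>y\<close> treats both signs at once: for
    \<open>y = - 1\<close> the negated vector encodes the solution.\<close>
  define x where "x = vec n (\<lambda>i. nat (z $ i * y))"
  have x: "int (x $ i) = z $ i * y" if "i < n" for i
    using bit[OF that] that by (auto simp: x_def)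
  have yy: "y * y = 1" using y by auto
  have x01: "x $ i \<in> {0, 1}" if "i < n" for i using bit[OF that] that by (auto simp: x_def)
  have "int (\<Sum>i<n. a ! i * x $ i) = (\<Sum>i<n. int (a ! i) * z $ i) * y"
    by (simp add: x sum_distrib_right mult.assoc)
  also have "\<dots> = int s" using A yy by (simp add: A_def mult.assoc)
  finally have "(\<Sum>i<n. a ! i * x $ i) = s" by linarith
  moreover have "real (card {i. i < n \<and> x $ i = 1}) = 5 / 6 * real n"
  proof -
    have "int (\<Sum>i<n. x $ i) = (\<Sum>i<n. z $ i) * y" by (simp add: x sum_distrib_right)
    also have "\<dots> = 5 * int m" using C yy by (simp add: C_def mult.assoc)
    finally have "(\<Sum>i<n. x $ i) = 5 * m" by linarith
    moreover have "(\<Sum>i<n. x $ i) = (\<Sum>i<n. if x $ i = 1 then 1 else 0)"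
      using x01 by (intro sum.cong) auto
    moreover have "\<dots> = card {i. i < n \<and> x $ i = 1}"
      by (simp add: sum.If_cases Int_def)
    ultimately show ?thesis using n by simp
  qed
  moreover have "x \<in> carrier_vec n" by (simp add: x_def)
  ultimately show ?thesis
    unfolding ss_solvable_def n_def[symmetric] using x01 by blast
qed

text \<open>With last coefficient 1 both constraints vanish, and every \<open>x $ j - 1 / 2\<close>
  has absolute value \<open>1 / 2\<close>, so the threshold is met with equality.\<close>

lemma solvable_imp_short_vector:
  assumes p: "1 \<le> p" and "a \<noteq> []" and "ss_solvable (5 / 6) a s"
  obtains z :: "int vec" where "z \<in> carrier_vec (length a + 1)" "z \<noteq> 0\<^sub>v (length a + 1)"
    "lp_norm p (real_basis a s *\<^sub>v map_vec real_of_int z) \<le> 1 / 2 * real (length a) powr (1 / p)"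
proof -
  define n where "n = length a"
  from assms(3) obtain x :: "nat vec" where x: "x \<in> carrier_vec n" "\<And>i. i < n \<Longrightarrow> x $ i \<in> {0, 1}"
    and A: "(\<Sum>i<n. a ! i * x $ i) = s" and card: "real (card {i. i < n \<and> x $ i = 1}) = 5 / 6 * real n"
    unfolding ss_solvable_def n_def by blast
  have "(\<Sum>i<n. x $ i) = (\<Sum>i<n. if x $ i = 1 then 1 else 0)"
    using x by (intro sum.cong) auto
  also have "\<dots> = card {i. i < n \<and> x $ i = 1}"
    by (simp add: sum.If_cases Int_def)
  finally have C: "(\<Sum>i<n. real (x $ i)) = 5 / 6 * real n" using card by (simp flip: of_nat_sum)
  define z where "z = vec (n + 1) (\<lambda>i. if i = n then 1 else int (x $ i))"
  have z: "z \<in> carrier_vec (length a + 1)" by (simp add: z_def n_def)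
  have z_n: "z $ n = 1" and z_x: "\<And>i. i < n \<Longrightarrow> z $ i = int (x $ i)" by (simp_all add: z_def)
  have "(\<Sum>i<n. int (a ! i) * z $ i) = int s"
    by (simp add: z_x flip: A)
  moreover have "6 / 5 * real_of_int (\<Sum>i<n. z $ i) - real n = 0" by (simp add: z_x C)
  moreover have "(\<Sum>j<n. \<bar>real_of_int (z $ j) - 1 / 2\<bar> powr p) = (\<Sum>j<n. (1 / 2) powr p)"
  proof (rule sum.cong)
    fix j assume "j \<in> {..<n}"
    then show "\<bar>real_of_int (z $ j) - 1 / 2\<bar> powr p = (1 / 2) powr p"
      using x(2)[of j] by (auto simp: z_x)
  qed simp
  ultimately have "lp_norm p (real_basis a s *\<^sub>v map_vec real_of_int z) \<le> 1 / 2 * real (length a) powr (1 / p)"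
    using p unfolding lp_norm_le_half_iff[OF p] sum_powr_real_basis[OF z]
    by (simp add: z_n flip: n_def del: of_int_sum)
  moreover have "z \<noteq> 0\<^sub>v (length a + 1)" using z_n by (auto simp: n_def)
  ultimately show ?thesis using that z by blast
qed

section \<open>The reduction\<close>

lemma enc_int_of_nat: "enc_int (int n) = False # enc_bits (bits n)"
  by (simp add: enc_int_def enc_nat_def)

lemma enc_rat_of_nat: "enc_rat (of_nat n) = False # enc_bits (bits n) @ enc_int 1"
  using enc_rat_of_int[of "int n"] by (simp add: enc_int_of_nat)

text \<open>Positivity enters through the sign bit: the code of 0 begins with
  \<open>False\<close>.\<close>

lemma enc_rat_minus_of_nat:
  assumes "0 < n"
  shows "enc_rat (- of_nat n) = True # enc_bits (bits n) @ enc_int 1"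
  using enc_rat_of_int[of "- int n"] assms by (simp add: enc_int_def enc_nat_def)

lemma take_list_enc_list: "take_list (enc_list enc_nat a) = map bits a"
  by (induction a) (simp_all add: enc_nat_def take_bits_enc_bits drop_bits_enc_bits)

lemma concat_triples:
  "concat (map f [0..<3 * n]) = concat (map (\<lambda>j. f (3 * j) @ f (3 * j + 1) @ f (3 * j + 2)) [0..<n])"
proof (induction n)
  case (Suc n)
  have *: "3 * Suc n = Suc (Suc (Suc (3 * n)))" by simp
  show ?case unfolding * upt_Suc_append[OF le0] map_append concat_append Suc.IH by simp
qed simp

lemma enc_col_svp_basis:
  assumes "i < length a + 1"
  shows "enc_list enc_rat (list_of_vec (col (svp_basis a s) i)) =
    concat (map (\<lambda>j. True # enc_rat (svp_basis a s $$ (3 * j, i)) @ True # enc_rat (svp_basis a s $$ (3 * j + 1, i)) @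
      True # enc_rat (svp_basis a s $$ (3 * j + 2, i))) [0..<length a]) @ [False]"
proof -
  have "list_of_vec (col (svp_basis a s) i) = map (\<lambda>r. svp_basis a s $$ (r, i)) [0..<3 * length a]"
    using assms by (intro nth_equalityI) (simp_all add: list_of_vec_index)
  then show ?thesis by (simp add: enc_list_conv concat_triples comp_def)
qed

lemma enc_weight_column:
  assumes "i < length a"
  shows "enc_list enc_rat (list_of_vec (col (svp_basis a s) i)) = weight_column (length a) i (bits (a ! i))"
proof -
  have "map (\<lambda>j. True # enc_rat (svp_basis a s $$ (3 * j, i)) @ True # enc_rat (svp_basis a s $$ (3 * j + 1, i)) @
      True # enc_rat (svp_basis a s $$ (3 * j + 2, i))) [0..<length a] =
      map (\<lambda>j. weight_entries (if j = i then 1 else 0) (bits (a ! i))) [0..<length a]"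
  proof (rule map_cong)
    fix j assume "j \<in> set [0..<length a]"
    then have "j < length a" by simp
    show "True # enc_rat (svp_basis a s $$ (3 * j, i)) @ True # enc_rat (svp_basis a s $$ (3 * j + 1, i)) @
        True # enc_rat (svp_basis a s $$ (3 * j + 2, i)) =
        weight_entries (if j = i then 1 else 0) (bits (a ! i))"
      unfolding index_svp_basis[OF \<open>j < length a\<close> assms] weight_entries_def enc_rat_of_nat by simp
  qed simp
  then show ?thesis
    using assms by (simp only: weight_column_def enc_col_svp_basis trans_less_add1)
qed

lemma enc_target_column:
  assumes "a \<noteq> []" "0 < s"
  shows "enc_list enc_rat (list_of_vec (col (svp_basis a s) (length a))) =
    target_column (length a) (bits s) (bits (length a))"
proof -
  have "svp_basis a s $$ (3 * j, length a) = - 1 / 2" "svp_basis a s $$ (3 * j + 1, length a) = - of_nat s"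
    "svp_basis a s $$ (3 * j + 2, length a) = - of_nat (length a)" if "j < length a" for j
    using index_svp_basis[OF that that] by simp_all
  then have "map (\<lambda>j. True # enc_rat (svp_basis a s $$ (3 * j, length a)) @ True # enc_rat (svp_basis a s $$ (3 * j + 1, length a)) @
      True # enc_rat (svp_basis a s $$ (3 * j + 2, length a))) [0..<length a] =
      replicate (length a) (target_entries (bits s) (bits (length a)))"
    using assms by (intro nth_equalityI) (simp_all add: target_entries_def enc_rat_minus_of_nat)
  then show ?thesis
    by (simp only: target_column_def enc_col_svp_basis less_add_one)
qed

text \<open>On codes the parsers return exact binary digits, so every block is literally the code of
  a triple of matrix entries. Positivity of \<open>s\<close> and of the number of weights makes the
  hard-wired minus signs correct.\<close>

lemma reduction_enc_ss:
  assumes "a \<noteq> []" "0 < s"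
  shows "reduction (enc_ss a s) = enc_gapsvp (svp_basis a s) (1 / 2) (of_nat (length a))"
proof -
  have "take_bits (enc_ss a s) = bits s" "drop_bits (enc_ss a s) = enc_list enc_nat a"
    by (simp_all add: enc_ss_def enc_nat_def take_bits_enc_bits drop_bits_enc_bits)
  moreover have columns: "map (\<lambda>i. True # weight_column (length a) i (map bits a ! i)) [0..<length a] =
      map (\<lambda>i. True # weight_column (length a) i (bits (a ! i))) [0..<length a]"
    by (intro map_cong) auto
  ultimately have "reduction (enc_ss a s) = enc_rat (1 / 2) @ enc_rat (of_nat (length a)) @
     concat (map (\<lambda>i. True # weight_column (length a) i (bits (a ! i))) [0..<length a]) @
     True # target_column (length a) (bits s) (bits (length a)) @ [False]"
    by (simp add: reduction_def Let_def take_list_enc_list enc_rat_of_nat columns)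
  moreover have "map (\<lambda>i. True # enc_list enc_rat (list_of_vec (col (svp_basis a s) i))) [0..<length a] =
      map (\<lambda>i. True # weight_column (length a) i (bits (a ! i))) [0..<length a]"
    by (intro map_cong) (auto simp: enc_weight_column)
  then have "enc_list (\<lambda>b. enc_list enc_rat (list_of_vec b)) (cols (svp_basis a s)) =
      concat (map (\<lambda>i. True # weight_column (length a) i (bits (a ! i))) [0..<length a]) @
      True # target_column (length a) (bits s) (bits (length a)) @ [False]"
    using enc_target_column[OF assms]
    by (simp add: cols_def enc_list_conv[of _ "_ @ _"] comp_def del: map_eq_conv)
  ultimately show ?thesis by (simp add: enc_gapsvp_def)
qed

section \<open>Comparison of the minimum with the threshold\<close>

text \<open>10 clears the denominators 2 and 5 of the basis, which provides the discreteness behind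
  the existence of a shortest vector.\<close>

lemma real_basis_mult_10_Ints:
  fixes z :: "int vec"
  assumes "z \<in> carrier_vec (length a + 1)" "r < 3 * length a"
  shows "real 10 * (real_basis a s *\<^sub>v map_vec real_of_int z) $ r \<in> \<int>"
proof -
  define j where "j = r div 3"
  have j: "j < length a" and r: "r = 3 * j \<or> r = 3 * j + 1 \<or> r = 3 * j + 2"
    using assms(2) unfolding j_def by auto
  have z: "map_vec real_of_int z \<in> carrier_vec (length a + 1)" using assms(1) by simp
  define y where "y = z $ length a"
  have "real 10 * (real_basis a s *\<^sub>v map_vec real_of_int z) $ (3 * j) = real_of_int (10 * z $ j - 5 * y)"
    "real 10 * (real_basis a s *\<^sub>v map_vec real_of_int z) $ (3 * j + 1) =
      real_of_int (10 * ((\<Sum>i<length a. int (a ! i) * z $ i) - int s * y))"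
    "real 10 * (real_basis a s *\<^sub>v map_vec real_of_int z) $ (3 * j + 2) =
      real_of_int (12 * (\<Sum>i<length a. z $ i) - 10 * int (length a) * y)"
    unfolding real_basis_mult[OF z j] using assms(1) j by (simp_all add: y_def algebra_simps)
  note * = this
  show ?thesis using r by (elim disjE) (simp_all only: * Ints_of_int)
qed

lemma gapsvp_instance_svp_basis:
  assumes "a \<noteq> []"
  shows "gapsvp_instance (svp_basis a s) (1 / 2) (of_nat (length a))"
  using is_basis_real_basis[OF assms, of s] assms by (simp add: gapsvp_instance_def real_basis_def)

lemma lambda1_le_threshold_iff:
  assumes p: "1 \<le> p" and m: "0 < m" "length a = 6 * m" and indep: "\<not> p_dependent p (1 / 2) a"
  shows "lambda1 p (lattice_of (map_mat real_of_rat (svp_basis a s))) \<le> threshold p (1 / 2) (of_nat (length a))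
    \<longleftrightarrow> ss_solvable (5 / 6) a s"
proof -
  let ?L = "lattice_of (real_basis a s)" and ?v = "\<lambda>z. real_basis a s *\<^sub>v map_vec real_of_int z"
  let ?n = "length a"
  have L: "v \<in> ?L \<longleftrightarrow> (\<exists>z\<in>carrier_vec (?n + 1). v = ?v z)" for v
    by (auto simp: lattice_of_def)
  have a: "a \<noteq> []" using m by auto
  \<comment> \<open>\<open>lambda1\<close> speaks of nonzero vectors, the two implications of
    nonzero coefficients; linear independence identifies the two.\<close>
  have nonzero: "?v z = 0\<^sub>v (3 * ?n) \<longleftrightarrow> z = 0\<^sub>v (?n + 1)" if "z \<in> carrier_vec (?n + 1)" for z
  proof
    assume "?v z = 0\<^sub>v (3 * ?n)"
    then have *: "map_vec real_of_int z = 0\<^sub>v (?n + 1)"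
      using that a by (intro real_basis_mult_eq_0) simp_all
    show "z = 0\<^sub>v (?n + 1)"
    proof (rule eq_vecI)
      fix i assume "i < dim_vec (0\<^sub>v (?n + 1) :: int vec)"
      then show "z $ i = 0\<^sub>v (?n + 1) $ i"
        using that arg_cong[OF *, of "\<lambda>v. v $ i"] by simp
    qed (use that in simp)
  qed (auto intro!: eq_vecI simp: scalar_prod_def)
  \<comment> \<open>Any nonzero lattice vector will do as the starting point for the finite search;
    this picks the last column of the basis.\<close>
  define z1 :: "int vec" where "z1 = unit_vec (?n + 1) ?n"
  have z1: "z1 \<in> carrier_vec (?n + 1)" "z1 \<noteq> 0\<^sub>v (?n + 1)"
    by (simp_all add: z1_def)
  have carrier: "?L \<subseteq> carrier_vec (3 * ?n)"
  proof
    fix v assume "v \<in> ?L"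
    then obtain z where v: "v = ?v z" using L by blast
    show "v \<in> carrier_vec (3 * ?n)" unfolding v by (rule carrier_vecI) simp
  qed
  have ints: "real 10 * v $ r \<in> \<int>" if "v \<in> ?L" "r < 3 * ?n" for v r
  proof -
    from that(1) obtain z where z: "z \<in> carrier_vec (?n + 1)" "v = ?v z" using L by blast
    show ?thesis unfolding z(2) by (rule real_basis_mult_10_Ints[OF z(1) that(2)])
  qed
  have v1: "?v z1 \<in> ?L" "?v z1 \<noteq> 0\<^sub>v (3 * ?n)" using z1 nonzero[OF z1(1)] L by blast+
  from lambda1_attained[OF p zero_less_numeral carrier ints v1] obtain v where v: "v \<in> ?L" "v \<noteq> 0\<^sub>v (3 * ?n)" "lambda1 p ?L = lp_norm p v"
    and min: "\<And>w. w \<in> ?L \<Longrightarrow> w \<noteq> 0\<^sub>v (3 * ?n) \<Longrightarrow> lambda1 p ?L \<le> lp_norm p w"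
    by blast
  obtain z where z: "z \<in> carrier_vec (?n + 1)" "v = ?v z" using v(1) L by blast
  have threshold: "threshold p (1 / 2) (of_nat ?n) = 1 / 2 * real ?n powr (1 / p)"
    by (simp add: threshold_def of_rat_divide)
  have "lambda1 p ?L \<le> 1 / 2 * real ?n powr (1 / p) \<longleftrightarrow> ss_solvable (5 / 6) a s"
  proof
    assume "lambda1 p ?L \<le> 1 / 2 * real ?n powr (1 / p)"
    moreover have "z \<noteq> 0\<^sub>v (?n + 1)" using v(2) z nonzero by blast
    ultimately show "ss_solvable (5 / 6) a s"
      using short_vector_imp_solvable[OF p m indep z(1)] v(3) z(2) by simp
  next
    assume "ss_solvable (5 / 6) a s"
    then obtain z' where z': "z' \<in> carrier_vec (?n + 1)" "z' \<noteq> 0\<^sub>v (?n + 1)"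
      and short: "lp_norm p (?v z') \<le> 1 / 2 * real ?n powr (1 / p)"
      using solvable_imp_short_vector[OF p a] by blast
    have "lambda1 p ?L \<le> lp_norm p (?v z')"
      using min z' nonzero L by blast
    with short show "lambda1 p ?L \<le> 1 / 2 * real ?n powr (1 / p)" by simp
  qed
  then show ?thesis by (simp only: threshold real_basis_def)
qed

theorem corollary3p11:
  fixes p c \<alpha> :: real
  assumes "p \<ge> 1" and "c = 5 / 6" and "\<alpha> = 1 / 2"
  shows "\<exists>f. karp_reduction f (SS c p \<alpha>) (GapSVP p) \<and>
    (\<forall>a s. ss_instance c a s \<and> \<not> p_dependent p \<alpha> a \<longrightarrow>
      (\<exists>B u v. f (enc_ss a s) = enc_gapsvp B u v \<and> gapsvp_instance B u v \<and>
        dim_col B = length a + 1))"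
proof -
  have inst: "0 < s \<and> a \<noteq> [] \<and> (\<exists>m>0. length a = 6 * m)" if ss: "ss_instance c a s" for a s
  proof -
    from ss obtain k where k: "0 < s" "0 < k" "5 / 6 * real (length a) = real k"
      unfolding ss_instance_def assms(2) by blast
    then have "real (5 * length a) = real (6 * k)" by simp
    then have eq: "5 * length a = 6 * k" by (simp only: of_nat_eq_iff)
    \<comment> \<open>From \<open>5 * n = 6 * k\<close> follows \<open>n = 6 * n - 6 * k\<close>,
      which gives the witness \<open>m = n - k\<close>.\<close>
    then have "length a = 6 * (length a - k)" "0 < length a - k" using k(2) by linarith+
    moreover from this(2) have "a \<noteq> []" by auto
    ultimately show ?thesis using k(1) by blast
  qed
  have yes_iff: "lambda1 p (lattice_of (map_mat real_of_rat (svp_basis a s))) \<le>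
      threshold p (1 / 2) (of_nat (length a)) \<longleftrightarrow> ss_solvable c a s"
    if "ss_instance c a s" "\<not> p_dependent p \<alpha> a" for a s
    using inst[OF that(1)] that(2) lambda1_le_threshold_iff[OF assms(1)] assms(2,3) by blast
  have "reduction ` fst (SS c p \<alpha>) \<subseteq> fst (GapSVP p)"
  proof
    fix x assume "x \<in> reduction ` fst (SS c p \<alpha>)"
    then obtain a s where "x = reduction (enc_ss a s)" and
      *: "ss_instance c a s" "\<not> p_dependent p \<alpha> a" "ss_solvable c a s"
      by (auto simp: SS_def)
    then have "x = enc_gapsvp (svp_basis a s) (1 / 2) (of_nat (length a))"
      using inst reduction_enc_ss by blast
    moreover have "gapsvp_instance (svp_basis a s) (1 / 2) (of_nat (length a))"
      using inst[OF *(1)] gapsvp_instance_svp_basis by blast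
    moreover have "lambda1 p (lattice_of (map_mat real_of_rat (svp_basis a s))) \<le>
      threshold p (1 / 2) (of_nat (length a))" using * yes_iff by blast
    ultimately show "x \<in> fst (GapSVP p)" unfolding GapSVP_def fst_conv by blast
  qed
  moreover have "reduction ` snd (SS c p \<alpha>) \<subseteq> snd (GapSVP p)"
  proof
    fix x assume "x \<in> reduction ` snd (SS c p \<alpha>)"
    then obtain a s where "x = reduction (enc_ss a s)" and
      *: "ss_instance c a s" "\<not> p_dependent p \<alpha> a" "\<not> ss_solvable c a s"
      by (auto simp: SS_def)
    then have "x = enc_gapsvp (svp_basis a s) (1 / 2) (of_nat (length a))"
      using inst reduction_enc_ss by blast
    moreover have "gapsvp_instance (svp_basis a s) (1 / 2) (of_nat (length a))"
      using inst[OF *(1)] gapsvp_instance_svp_basis by blast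
    moreover have "threshold p (1 / 2) (of_nat (length a)) <
      lambda1 p (lattice_of (map_mat real_of_rat (svp_basis a s)))"
      using * yes_iff by (meson not_le)
    ultimately show "x \<in> snd (GapSVP p)" unfolding GapSVP_def snd_conv by blast
  qed
  ultimately have "karp_reduction reduction (SS c p \<alpha>) (GapSVP p)"
    unfolding karp_reduction_def using poly_time_reduction by blast
  moreover have "\<exists>B u v. reduction (enc_ss a s) = enc_gapsvp B u v \<and> gapsvp_instance B u v \<and>
      dim_col B = length a + 1" if "ss_instance c a s" for a s
    using inst[OF that] reduction_enc_ss gapsvp_instance_svp_basis dim_svp_basis(2) by blast
  ultimately show ?thesis by blast
qed

end
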